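(* Let $(G,K)$ be a compact Gelfand pair. Then for any continuous positive definite $K$-bi-invariant function $f:G\to\mathbb{R}$, there exists a positive definite $K$-bi-invariant function $g:G\to\mathbb{C}$ in $L^2(G)$ such that $f=g\ast g$.
   Context: For a locally compact group $G$ with (left) Haar measure $\lambda_G$, the convolution of two functions is $f_1\ast f_2(x)=\int_G f_1(y)f_2(y^{-1}x)\,d\lambda_G(y)$. For a compact subgroup $K$, a function $f:G\to\mathbb{C}$ is $K$-bi-invariant if $f(kxk')=f(x)$ for all $x\in G$, $k,k'\in K$. The pair $(G,K)$ is a Gelfand pair if the algebra $C_c^K(G)$ of continuous compactly supported $K$-bi-invariant complex-valued functions on $G$ is commutative under convolution; it is a compact Gelfand pair if in addition $G$ is compact. A function $f:G\to\mathbb{C}$ is positive definite if $\sum_{i,j=1}^n c_i\overline{c_j}f(x_i^{-1}x_j)\ge0$ for all $n\in\mathbb{N}$, $c_i\in\mathbb{C}$, $x_i\in G$.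
   Formalization: Positive definiteness of g is taken in the integral L² sense (tested against continuous functions) instead of over finite point families; with the pointwise sense the claim fails, e.g. on the circle for f(x)=Σ cos(2πnx)/n², since g would be bounded with summable Fourier coefficients. *)

theory Defs
  imports "HOL-Analysis.Analysis"
begin

text \<open>
  Groups are written additively: the class \<^class>\<open>topological_group_add\<close> does not assume
  commutativity, so \<open>- y + x\<close> stands for $y^{-1}x$ and \<open>0\<close> for the identity.
  Topological groups are Hausdorff throughout.
\<close>

definition left_haar_measure :: "'a::{topological_group_add,t2_space} measure \<Rightarrow> bool" where
  "left_haar_measure M \<longleftrightarrow>
     sets M = sets borel \<and>
     emeasure M UNIV \<noteq> 0 \<and>
     (\<forall>C. compact C \<longrightarrow> emeasure M C < \<infinity>) \<and>
     (\<forall>A\<in>sets borel. emeasure M A = (INF U\<in>{U. open U \<and> A \<subseteq> U}. emeasure M U)) \<and>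
     (\<forall>U. open U \<longrightarrow> emeasure M U = (SUP C\<in>{C. compact C \<and> C \<subseteq> U}. emeasure M C)) \<and>
     (\<forall>x. \<forall>A\<in>sets borel. emeasure M ((\<lambda>y. x + y) ` A) = emeasure M A)"

definition convolution ::
    "'a::group_add measure \<Rightarrow> ('a \<Rightarrow> complex) \<Rightarrow> ('a \<Rightarrow> complex) \<Rightarrow> 'a \<Rightarrow> complex" where
  "convolution M f1 f2 x = (\<integral>y. f1 y * f2 (- y + x) \<partial>M)"

definition compact_subgroup :: "'a::{topological_group_add,t2_space} set \<Rightarrow> bool" where
  "compact_subgroup K \<longleftrightarrow>
     compact K \<and> 0 \<in> K \<and> (\<forall>x\<in>K. \<forall>y\<in>K. x + y \<in> K) \<and> (\<forall>x\<in>K. - x \<in> K)"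

definition bi_invariant :: "'a::group_add set \<Rightarrow> ('a \<Rightarrow> 'b) \<Rightarrow> bool" where
  "bi_invariant K f \<longleftrightarrow> (\<forall>x. \<forall>k\<in>K. \<forall>k'\<in>K. f (k + x + k') = f x)"

definition Cc :: "('a::topological_space \<Rightarrow> complex) set" where
  "Cc = {f. continuous_on UNIV f \<and> compact (closure {x. f x \<noteq> 0})}"

text \<open>
  The Haar measure \<open>M\<close> enters only through convolution; it is unique up to a positive factor, so
  the property does not depend on the choice of \<open>M\<close>.
\<close>

definition gelfand_pair ::
    "'a::{topological_group_add,t2_space} measure \<Rightarrow> 'a set \<Rightarrow> bool" where
  "gelfand_pair M K \<longleftrightarrow>
     locally_compact_space (euclidean :: 'a topology) \<and>
     left_haar_measure M \<and>
     compact_subgroup K \<and>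
     (\<forall>f1\<in>Cc. \<forall>f2\<in>Cc. bi_invariant K f1 \<longrightarrow> bi_invariant K f2 \<longrightarrow>
        convolution M f1 f2 = convolution M f2 f1)"

definition compact_gelfand_pair ::
    "'a::{topological_group_add,t2_space} measure \<Rightarrow> 'a set \<Rightarrow> bool" where
  "compact_gelfand_pair M K \<longleftrightarrow> gelfand_pair M K \<and> compact (UNIV :: 'a set)"

definition positive_definite :: "('a::group_add \<Rightarrow> complex) \<Rightarrow> bool" where
  "positive_definite f \<longleftrightarrow>
     (\<forall>(n::nat) (c :: nat \<Rightarrow> complex) (x :: nat \<Rightarrow> 'a).
        (\<Sum>i<n. \<Sum>j<n. c i * cnj (c j) * f (- x i + x j)) \<in> \<real>\<^sub>\<ge>\<^sub>0)"

text \<open>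
  Positive definiteness for elements of $L^2$, with the sums over finite families of points
  replaced by integrals against test functions in \<^const>\<open>Cc\<close>. It depends only on the class of
  \<open>g\<close> modulo null sets and agrees with \<^const>\<open>positive_definite\<close> for continuous \<open>g\<close>. The pointwise
  condition is not suitable for $L^2$: it forces $|g(x)| \le g(0)$, hence boundedness, and already
  on the circle the function $f(x) = \sum_{n \ge 1} n^{-2} \cos(2 \pi n x)$ has no convolution
  square root that is positive definite in the pointwise sense.
\<close>

definition positive_definite_L2 ::
    "'a::{topological_group_add,t2_space} measure \<Rightarrow> ('a \<Rightarrow> complex) \<Rightarrow> bool" where
  "positive_definite_L2 M g \<longleftrightarrow>
     (\<forall>\<phi>\<in>Cc. (\<integral>x. (\<integral>y. \<phi> x * cnj (\<phi> y) * g (- x + y) \<partial>M) \<partial>M) \<in> \<real>\<^sub>\<ge>\<^sub>0)"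

definition square_integrable :: "'a measure \<Rightarrow> ('a \<Rightarrow> complex) \<Rightarrow> bool" where
  "square_integrable M g \<longleftrightarrow>
     g \<in> borel_measurable M \<and> integrable M (\<lambda>x. (cmod (g x))\<^sup>2)"

end

theory Submission
  imports Defs "HOL-Computational_Algebra.Polynomial"
begin

text \<open>
  Scale \<open>f\<close> so that convolution with \<open>f\<close> is a self-adjoint operator \<open>T\<close> on continuous functions with
  \<open>0 \<le> T \<le> 1\<close>. Convolving \<open>p(T) f\<close> with \<open>q(T) f\<close> gives \<open>(t p q)(T) f\<close>, so \<open>T\<^sup>-\<^sup>1\<^sup>/\<^sup>2 f\<close>
  is formally a convolution square root of \<open>f\<close>. Put \<open>r\<^sub>0 = 0\<close> and
  \<open>r\<^sub>n\<^sub>+\<^sub>1 = r\<^sub>n + (1 - t r\<^sub>n\<^sup>2) / 2\<close>, which increases to \<open>1 / sqrt t\<close> on \<open>(0, 1]\<close>. As \<open>1 - t r\<^sub>n\<^sup>2\<close> acts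
  positively, \<open>\<parallel>r\<^sub>n(T) f\<parallel>\<^sup>2 = (t r\<^sub>n\<^sup>2)(T) f (0) \<le> f (0)\<close>, and \<open>g\<^sub>n = r\<^sub>n(T) f\<close> is a Cauchy sequence in \<open>L\<^sup>2\<close>;
  its limit \<open>g\<close> satisfies \<open>f - g * g = lim 2 (g\<^sub>n\<^sub>+\<^sub>1 - g\<^sub>n) = 0\<close>.
  Choosing \<open>g\<close> as the pointwise limit of a subsequence makes it symmetric and bi-invariant everywhere,
  and symmetry replaces the inversion invariance of the Haar measure.
\<close>

lemma small_multiple:
  fixes d c :: real
  assumes "d > 0" "c \<ge> 0"
  obtains e where "e > 0" "e * c \<le> d"
proof
  show "d / (c + 1) > 0" using assms by (simp add: add_nonneg_pos)
  show "d / (c + 1) * c \<le> d" using assms by (simp add: field_simps)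
qed

section \<open>Haar measure on a compact group\<close>

locale compact_haar =
  fixes M :: "'a::{topological_group_add,t2_space} measure"
  assumes haar: "left_haar_measure M"
    and compact_UNIV: "compact (UNIV :: 'a set)"
begin

lemmas haar_conjs = haar[unfolded left_haar_measure_def]

lemma sets_M [measurable_cong]: "sets M = sets borel"
  by (rule haar_conjs[THEN conjunct1])

lemma space_M [simp]: "space M = UNIV"
  using sets_eq_imp_space_eq[OF sets_M] by simp

sublocale finite_measure M
proof
  show "emeasure M (space M) \<noteq> \<infinity>"
    using haar_conjs[THEN conjunct2, THEN conjunct2, THEN conjunct1] compact_UNIV by auto
qed

lemma emeasure_translate:
  assumes "A \<in> sets borel"
  shows "emeasure M ((\<lambda>y. x + y) ` A) = emeasure M A"
  by (rule haar_conjs[THEN conjunct2, THEN conjunct2, THEN conjunct2, THEN conjunct2,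
        THEN conjunct2, rule_format, OF assms])

lemma continuous_translate: "continuous_on UNIV (\<lambda>y::'a. x + y)"
  by (intro continuous_intros)

text \<open>The Haar axiom speaks of images under translation, while \<open>distr\<close> and
  continuity speak of preimages; this passes between the two.\<close>

lemma image_translate: "(+) (x::'a) ` U = (+) (-x) -` U"
proof -
  have "y \<in> (+) x ` U" if "- x + y \<in> U" for y
    using that by (intro image_eqI[of _ _ "- x + y"]) (auto simp: add.assoc[symmetric])
  then show ?thesis by (auto simp: add.assoc[symmetric])
qed

lemma distr_translate: "distr M M (\<lambda>y. x + y) = M"
proof (rule measure_eqI)
  fix A assume "A \<in> sets (distr M M ((+) x))"
  then have A: "A \<in> sets borel" by (simp add: sets_M)
  have [measurable]: "(+) x \<in> measurable M M"
    using borel_measurable_continuous_onI[OF continuous_translate[of x]]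
    by (simp add: measurable_cong_sets[OF sets_M sets_M])
  have "(+) x -` A = (+) (-x) ` A"
    by (simp add: image_translate)
  then show "emeasure (distr M M ((+) x)) A = emeasure M A"
    using A by (simp add: emeasure_distr sets_M emeasure_translate)
qed simp

lemma translate_measurable [measurable]: "(\<lambda>y. x + y) \<in> measurable M M"
  using borel_measurable_continuous_onI[OF continuous_translate[of x]]
  by (simp add: measurable_cong_sets[OF sets_M sets_M])

lemma integral_translate:
  fixes u :: "'a \<Rightarrow> 'b::{banach, second_countable_topology}"
  assumes "u \<in> borel_measurable M"
  shows "(\<integral>y. u (x + y) \<partial>M) = (\<integral>y. u y \<partial>M)"
  using integral_distr[OF translate_measurable[of x] assms] by (simp add: distr_translate)

lemma integrable_translate:
  fixes u :: "'a \<Rightarrow> 'b::{banach, second_countable_topology}"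
  assumes "integrable M u"
  shows "integrable M (\<lambda>y. u (x + y))"
proof -
  have "integrable (distr M M ((+) x)) u" by (simp add: assms distr_translate)
  then show ?thesis by (rule integrable_distr[OF translate_measurable])
qed

lemma measurable_continuous:
  assumes "continuous_on UNIV (u :: 'a \<Rightarrow> 'b::topological_space)"
  shows "u \<in> borel_measurable M"
  using borel_measurable_continuous_onI[OF assms] by (simp add: measurable_cong_sets[OF sets_M refl])

lemma continuous_bounded:
  assumes "continuous_on UNIV (u :: 'a \<Rightarrow> 'b::real_normed_vector)"
  obtains B where "B \<ge> 0" "\<And>x. norm (u x) \<le> B"
proof -
  have "bounded (range u)" using compact_continuous_image[OF assms compact_UNIV] by (rule compact_imp_bounded)
  then obtain B where "\<forall>x. norm (u x) \<le> B" by (auto simp: bounded_iff)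
  then show ?thesis using that[of B] by (meson norm_ge_zero order_trans)
qed

lemma integrable_continuous:
  fixes u :: "'a \<Rightarrow> 'b::{banach, second_countable_topology}"
  assumes "continuous_on UNIV u"
  shows "integrable M u"
proof -
  obtain B where "\<And>x. norm (u x) \<le> B" using continuous_bounded[OF assms] by blast
  then show ?thesis using measurable_continuous[OF assms] by (intro integrable_const_bound[where B=B]) auto
qed

text \<open>If \<open>U\<close> were null, so would be all its translates; by compactness finitely
  many of them cover the group, whose measure is nonzero.\<close>

lemma emeasure_open_pos:
  assumes "open U" "x \<in> U"
  shows "emeasure M U \<noteq> 0"
proof
  assume 0: "emeasure M U = 0"
  define V where "V z = (+) (z - x) ` U" for z
  have "V z = (+) (- (z - x)) -` U" for z
    unfolding V_def by (rule image_translate)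
  then have open_V: "open (V z)" for z
    using open_vimage[OF assms(1) continuous_translate] by simp
  have V: "z \<in> V z" for z
    unfolding V_def using assms(2) by (intro image_eqI[of _ _ x]) auto
  obtain D where D: "D \<subseteq> UNIV" "finite D" "UNIV \<subseteq> (\<Union>z\<in>D. V z)"
    by (rule compactE_image[OF compact_UNIV, of UNIV V]) (use V open_V in auto)
  have "emeasure M (V z) = 0" for z
    unfolding V_def using emeasure_translate[of U] assms(1) 0 by simp
  then have "(\<Union>z\<in>D. V z) \<in> null_sets M"
    using open_V by (intro null_sets_UN' countable_finite D) (auto simp: null_sets_def sets_M)
  with D have "emeasure M UNIV = 0" by (simp add: top.extremum_unique null_sets_def)
  with haar_conjs[THEN conjunct2, THEN conjunct1] show False by contradiction
qed

text \<open>The set where \<open>h\<close> is nonzero is open and, by the hypothesis, null, so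
  \<open>emeasure_open_pos\<close> makes it empty.\<close>

lemma continuous_eq_0:
  fixes h :: "'a \<Rightarrow> real"
  assumes h: "continuous_on UNIV h" and 0: "(\<integral>x. (h x)\<^sup>2 \<partial>M) = 0"
  shows "h x = 0"
proof (rule ccontr)
  assume x: "h x \<noteq> 0"
  have "AE x in M. (h x)\<^sup>2 = 0"
    using 0 integral_nonneg_eq_0_iff_AE[OF integrable_continuous[OF continuous_on_power[OF h, of 2]]] by simp
  then have "AE x in M. h x = 0" by simp
  then have "emeasure M {x. h x \<noteq> 0} = 0"
    using measurable_continuous[OF h] by (subst (asm) AE_iff_measurable[OF _ refl]) (auto)
  moreover have "open {x. h x \<noteq> 0}"
    using h by (intro open_Collect_neq continuous_intros)
  ultimately show False using emeasure_open_pos[of "{x. h x \<noteq> 0}" x] x by simp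
qed

section \<open>Integrals of continuous kernels on the product\<close>

text \<open>Since the Borel sets of \<open>G \<times> G\<close> need not be generated by rectangles of Borel sets, Fubini's
  theorem is replaced, for continuous kernels, by approximation with finite partitions.\<close>

lemma finite_partition:
  fixes F :: "'a \<times> 'a \<Rightarrow> real"
  assumes F: "continuous_on UNIV F" and e: "e > 0"
  obtains D A where "finite (D :: 'a set)" "\<And>z. z \<in> D \<Longrightarrow> A z \<in> sets borel"
    "disjoint_family_on A D" "(\<Union>z\<in>D. A z) = UNIV"
    "\<And>z x t. z \<in> D \<Longrightarrow> x \<in> A z \<Longrightarrow> \<bar>F (x, t) - F (z, t)\<bar> \<le> e"
proof -
  \<comment> \<open>Compactness of the second factor makes one neighbourhood of \<open>z\<close>
    work for all \<open>t\<close> at once.\<close>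
  have "\<exists>X. open X \<and> z \<in> X \<and> (\<forall>x\<in>X. \<forall>t. \<bar>F (x, t) - F (z, t)\<bar> \<le> e)" for z
    by (rule continuous_on_prod_compactE[of UNIV UNIV F z e])
       (use F e compact_UNIV in \<open>auto simp: dist_real_def intro!: exI\<close>)
  then obtain X where X: "\<And>z. open (X z)" "\<And>z. z \<in> X z"
    "\<And>z x t. x \<in> X z \<Longrightarrow> \<bar>F (x, t) - F (z, t)\<bar> \<le> e" by metis
  obtain D where D: "D \<subseteq> UNIV" "finite D" "UNIV \<subseteq> (\<Union>z\<in>D. X z)"
    by (rule compactE_image[OF compact_UNIV, of UNIV X]) (use X in auto)
  \<comment> \<open>\<open>D\<close> is enumerated so that \<open>disjointed\<close> can cut the
    cover into disjoint cells; indices from \<open>n\<close> on get the empty set. A cell may miss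
    its own label \<open>z\<close>, but it lies inside \<open>X z\<close>.\<close>
  obtain xs where xs: "set xs = D" "distinct xs" using finite_distinct_list[OF D(2)] by blast
  define n where "n = length xs"
  define B where "B = disjointed (\<lambda>i. if i < n then X (xs ! i) else {})"
  define idx where "idx z = (THE i. i < n \<and> xs ! i = z)" for z
  have idx: "idx (xs ! i) = i" if "i < n" for i
    unfolding idx_def using that xs by (intro the_equality) (auto simp: n_def nth_eq_iff_index_eq)
  have Dn: "D = (\<lambda>i. xs ! i) ` {..<n}" using xs by (auto simp: n_def set_conv_nth)
  have dis: "disjoint_family B" unfolding B_def by (rule disjoint_family_disjointed)
  have sub: "B i \<subseteq> (if i < n then X (xs ! i) else {})" for i
    unfolding B_def by (rule disjointed_subset)
  have UNB: "(\<Union>i. B i) = UNIV"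
    unfolding B_def UN_disjointed_eq using D(3) by (auto simp: Dn split: if_splits)
  show ?thesis
  proof (rule that[of D "\<lambda>z. B (idx z)"])
    show "finite D" by fact
    show "B (idx z) \<in> sets borel" if "z \<in> D" for z
      unfolding B_def disjointed_def using X(1) by (auto intro!: sets.Diff sets.finite_UN)
    show "disjoint_family_on (\<lambda>z. B (idx z)) D"
      unfolding disjoint_family_on_def Dn
    proof (intro ballI impI)
      fix u v assume "u \<in> (!) xs ` {..<n}" "v \<in> (!) xs ` {..<n}" "u \<noteq> v"
      then obtain i j where "i < n" "j < n" "u = xs ! i" "v = xs ! j" "i \<noteq> j" by blast
      then show "B (idx u) \<inter> B (idx v) = {}"
        using disjoint_family_onD[OF dis, of i j] by (simp add: idx)
    qed
    show "(\<Union>z\<in>D. B (idx z)) = UNIV"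
    proof -
      have "x \<in> (\<Union>z\<in>D. B (idx z))" for x
      proof -
        obtain i where i: "x \<in> B i" using UNB by blast
        with sub[of i] have "i < n" by (auto split: if_splits)
        with i show ?thesis by (intro UN_I[of "xs ! i"]) (simp_all add: Dn idx)
      qed
      then show ?thesis by blast
    qed
    show "\<bar>F (x, t) - F (z, t)\<bar> \<le> e" if "z \<in> D" "x \<in> B (idx z)" for z x t
    proof -
      from that(1) obtain i where i: "i < n" "z = xs ! i" unfolding Dn by blast
      then have "x \<in> X z" using that(2) sub[of i] idx[of i] by auto
      then show ?thesis by (rule X(3))
    qed
  qed
qed

lemma continuous_slice:
  assumes "continuous_on UNIV (F :: 'a \<times> 'a \<Rightarrow> 'b::topological_space)"
  shows "continuous_on UNIV (\<lambda>x. F (x, y))" "continuous_on UNIV (\<lambda>y. F (x, y))"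
  using assms by (auto intro!: continuous_on_compose2[OF assms] continuous_intros)

lemma integral_abs_diff_le:
  fixes u v :: "'a \<Rightarrow> real"
  assumes "integrable M u" "integrable M v" "\<And>x. \<bar>u x - v x\<bar> \<le> e"
  shows "\<bar>(\<integral>x. u x \<partial>M) - (\<integral>x. v x \<partial>M)\<bar> \<le> e * measure M UNIV"
proof -
  have "\<bar>(\<integral>x. u x \<partial>M) - (\<integral>x. v x \<partial>M)\<bar> = \<bar>\<integral>x. u x - v x \<partial>M\<bar>"
    using assms by simp
  also have "\<dots> \<le> (\<integral>x. \<bar>u x - v x\<bar> \<partial>M)" by (rule integral_abs_bound)
  also have "\<dots> \<le> (\<integral>x. e \<partial>M)" using assms by (intro integral_mono) auto
  finally show ?thesis by (simp add: mult.commute)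
qed

text \<open>Compactness makes \<open>F (x, y)\<close> close to \<open>F (x0, y)\<close> uniformly in
  \<open>y\<close>, and finiteness of the measure carries this through the integral.\<close>

lemma continuous_integral_kernel:
  fixes F :: "'a \<times> 'a \<Rightarrow> real"
  assumes F: "continuous_on UNIV F"
  shows "continuous_on UNIV (\<lambda>x. \<integral>y. F (x, y) \<partial>M)"
proof -
  have "((\<lambda>x. \<integral>y. F (x, y) \<partial>M) \<longlongrightarrow> (\<integral>y. F (x0, y) \<partial>M)) (nhds x0)" for x0
  proof (rule tendstoI)
    fix e :: real assume e: "e > 0"
    define d where "d = e / (2 * (measure M UNIV + 1))"
    have d: "d > 0" using e by (simp add: d_def add_nonneg_pos)
    obtain X where X: "x0 \<in> X" "open X" "\<forall>x\<in>X \<inter> UNIV. \<forall>t\<in>UNIV. dist (F (x, t)) (F (x0, t)) \<le> d"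
      by (rule continuous_on_prod_compactE[of UNIV UNIV F x0 d]) (use F d compact_UNIV in auto)
    have "dist (\<integral>y. F (x, y) \<partial>M) (\<integral>y. F (x0, y) \<partial>M) < e" if "x \<in> X" for x
    proof -
      have "\<bar>(\<integral>y. F (x, y) \<partial>M) - (\<integral>y. F (x0, y) \<partial>M)\<bar> \<le> d * measure M UNIV"
        using X(3) that by (intro integral_abs_diff_le integrable_continuous continuous_slice F) (auto simp: dist_real_def)
      also have "\<dots> < d * (2 * (measure M UNIV + 1))"
        using d by (intro mult_strict_left_mono) (auto intro: add_nonneg_pos)
      also have "\<dots> = e" unfolding d_def
        by (metis add_nonneg_pos less_irrefl measure_nonneg mult_eq_0_iff nonzero_eq_divide_eq zero_less_one zero_neq_numeral)
      finally show ?thesis by (simp add: dist_real_def)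
    qed
    then show "\<forall>\<^sub>F x in nhds x0. dist (\<integral>y. F (x, y) \<partial>M) (\<integral>y. F (x0, y) \<partial>M) < e"
      using X by (auto simp: eventually_nhds)
  qed
  then show ?thesis
    by (auto simp: continuous_on_def intro: tendsto_mono[OF at_within_le_nhds])
qed

lemma continuous_swap:
  assumes "continuous_on UNIV (F :: 'a \<times> 'a \<Rightarrow> real)"
  shows "continuous_on UNIV (\<lambda>p. F (snd p, fst p))"
  by (auto intro!: continuous_on_compose2[OF assms] continuous_intros)

text \<open>On each cell \<open>F\<close> is replaced by its value at the label; this gives a step
  function within \<open>e\<close> of \<open>F\<close>, whose integral is the weighted sum.\<close>

lemma integral_partition:
  fixes F :: "'a \<times> 'a \<Rightarrow> real"
  assumes F: "continuous_on UNIV F"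
    and D: "finite D" "\<And>z. z \<in> D \<Longrightarrow> A z \<in> sets borel"
    "disjoint_family_on A D" "(\<Union>z\<in>D. A z) = UNIV"
    "\<And>z x t. z \<in> D \<Longrightarrow> x \<in> A z \<Longrightarrow> \<bar>F (x, t) - F (z, t)\<bar> \<le> e"
  shows "\<bar>(\<integral>x. F (x, t) \<partial>M) - (\<Sum>z\<in>D. measure M (A z) * F (z, t))\<bar> \<le> e * measure M UNIV"
proof -
  let ?s = "\<lambda>x. \<Sum>z\<in>D. indicator (A z) x * F (z, t)"
  have s: "?s x = F (z, t)" if "z \<in> D" "x \<in> A z" for x z
  proof -
    have "?s x = (\<Sum>w\<in>D. if w = z then F (z, t) else 0)"
      using that D(3) by (intro sum.cong) (auto simp: disjoint_family_on_def indicator_def)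
    then show ?thesis using D(1) that by simp
  qed
  have int: "integrable M (\<lambda>x. indicator (A z) x * F (z, t))" if "z \<in> D" for z
    using D(2)[OF that] by (intro integrable_mult_left integrable_real_indicator) (auto simp: sets_M emeasure_eq_measure)
  have "(\<integral>x. ?s x \<partial>M) = (\<Sum>z\<in>D. measure M (A z) * F (z, t))"
    using int D(2) by (subst Bochner_Integration.integral_sum) (auto simp: sets_M intro!: sum.cong)
  moreover have "\<bar>F (x, t) - ?s x\<bar> \<le> e" for x
  proof -
    obtain z where "z \<in> D" "x \<in> A z" using D(4) by blast
    with s[of z x] D(5)[of z x t] show ?thesis by simp
  qed
  ultimately show ?thesis
    using integral_abs_diff_le[of "\<lambda>x. F (x, t)" ?s e] int
    by (simp add: integrable_continuous continuous_slice F)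
qed

text \<open>The same weighted sum approximates both iterated integrals: for the first, the previous
  bound is integrated over \<open>t\<close>; for the second, it is applied to the row
  integrals.\<close>

lemma integral_partition_iterated:
  fixes F :: "'a \<times> 'a \<Rightarrow> real"
  assumes F: "continuous_on UNIV F"
    and D: "finite D" "\<And>z. z \<in> D \<Longrightarrow> A z \<in> sets borel"
    "disjoint_family_on A D" "(\<Union>z\<in>D. A z) = UNIV"
    "\<And>z x t. z \<in> D \<Longrightarrow> x \<in> A z \<Longrightarrow> \<bar>F (x, t) - F (z, t)\<bar> \<le> e"
  shows "\<bar>(\<integral>t. \<integral>x. F (x, t) \<partial>M \<partial>M) - (\<Sum>z\<in>D. measure M (A z) * (\<integral>t. F (z, t) \<partial>M))\<bar>
           \<le> e * measure M UNIV * measure M UNIV"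
    and "\<bar>(\<integral>x. \<integral>t. F (x, t) \<partial>M \<partial>M) - (\<Sum>z\<in>D. measure M (A z) * (\<integral>t. F (z, t) \<partial>M))\<bar>
           \<le> e * measure M UNIV * measure M UNIV"
proof -
  have c: "continuous_on UNIV (\<lambda>t. \<integral>x. F (x, t) \<partial>M)"
    using continuous_integral_kernel[OF continuous_swap[OF F]] by simp
  have i: "integrable M (\<lambda>t. F (z, t))" for z
    by (intro integrable_continuous continuous_slice F)
  have "(\<Sum>z\<in>D. measure M (A z) * (\<integral>t. F (z, t) \<partial>M)) = (\<integral>t. (\<Sum>z\<in>D. measure M (A z) * F (z, t)) \<partial>M)"
    using i by simp
  then show "\<bar>(\<integral>t. \<integral>x. F (x, t) \<partial>M \<partial>M) - (\<Sum>z\<in>D. measure M (A z) * (\<integral>t. F (z, t) \<partial>M))\<bar>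
           \<le> e * measure M UNIV * measure M UNIV"
    using integral_partition[OF F D] i
    by (simp only:) (intro integral_abs_diff_le integrable_continuous[OF c] Bochner_Integration.integrable_sum integrable_mult_right, auto)
  \<comment> \<open>\<open>?G\<close> ignores its second argument, so
    \<open>integral_partition\<close> applies to the row integrals, and any value, here
    \<open>undefined\<close>, serves as \<open>t\<close>.\<close>
  let ?G = "\<lambda>p. \<integral>t. F (fst p, t) \<partial>M"
  have G: "continuous_on UNIV (?G :: 'a \<times> 'a \<Rightarrow> real)"
    by (rule continuous_on_compose2[OF continuous_integral_kernel[OF F]]) (auto intro: continuous_intros)
  have "\<bar>?G (x, t) - ?G (z, t)\<bar> \<le> e * measure M UNIV" if "z \<in> D" "x \<in> A z" for x z t
    using integral_abs_diff_le[OF i i D(5)[OF that]] by simp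
  from integral_partition[OF G D(1-4) this, of undefined]
  show "\<bar>(\<integral>x. \<integral>t. F (x, t) \<partial>M \<partial>M) - (\<Sum>z\<in>D. measure M (A z) * (\<integral>t. F (z, t) \<partial>M))\<bar>
           \<le> e * measure M UNIV * measure M UNIV"
    by simp
qed

text \<open>Both iterated integrals lie within \<open>e * measure M UNIV * measure M UNIV\<close> of
  one and the same sum, and \<open>e\<close> is arbitrary.\<close>

lemma fubini_continuous:
  fixes F :: "'a \<times> 'a \<Rightarrow> real"
  assumes F: "continuous_on UNIV F"
  shows "(\<integral>x. \<integral>t. F (x, t) \<partial>M \<partial>M) = (\<integral>t. \<integral>x. F (x, t) \<partial>M \<partial>M)"
proof -
  have "\<bar>(\<integral>x. \<integral>t. F (x, t) \<partial>M \<partial>M) - (\<integral>t. \<integral>x. F (x, t) \<partial>M \<partial>M)\<bar> \<le> d" if d: "d > 0" for d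
  proof -
    obtain e where e: "e > 0" "e * (2 * measure M UNIV * measure M UNIV) \<le> d"
      using small_multiple[OF d, of "2 * measure M UNIV * measure M UNIV"] by auto
    obtain D A where D: "finite (D :: 'a set)" "\<And>z. z \<in> D \<Longrightarrow> A z \<in> sets borel"
      "disjoint_family_on A D" "(\<Union>z\<in>D. A z) = UNIV"
      "\<And>z x t. z \<in> D \<Longrightarrow> x \<in> A z \<Longrightarrow> \<bar>F (x, t) - F (z, t)\<bar> \<le> e"
      using finite_partition[OF F e(1)] by blast
    show ?thesis using integral_partition_iterated[OF F D] e(2) by (simp add: algebra_simps)
  qed
  then show ?thesis using field_le_epsilon[of "\<bar>(\<integral>x. \<integral>t. F (x, t) \<partial>M \<partial>M) - (\<integral>t. \<integral>x. F (x, t) \<partial>M \<partial>M)\<bar>" 0] by simp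
qed

text \<open>With the cell measures as weights, the quadratic form in \<open>pos\<close> approximates
  the double integral to any accuracy.\<close>

lemma symmetric_kernel_nonneg:
  fixes F :: "'a \<times> 'a \<Rightarrow> real"
  assumes F: "continuous_on UNIV F" and sym: "\<And>x y. F (x, y) = F (y, x)"
    and pos: "\<And>D w. finite (D :: 'a set) \<Longrightarrow> (\<Sum>z\<in>D. \<Sum>z'\<in>D. w z * w z' * F (z, z')) \<ge> 0"
  shows "(\<integral>x. \<integral>y. F (x, y) \<partial>M \<partial>M) \<ge> 0"
proof -
  have "0 \<le> (\<integral>x. \<integral>t. F (x, t) \<partial>M \<partial>M) + d" if d: "d > 0" for d
  proof -
    let ?m = "measure M UNIV"
    obtain e where e: "e > 0" "e * (2 * ?m * ?m) \<le> d"
      using small_multiple[OF d, of "2 * ?m * ?m"] by auto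
    obtain D A where D: "finite (D :: 'a set)" "\<And>z. z \<in> D \<Longrightarrow> A z \<in> sets borel"
      "disjoint_family_on A D" "(\<Union>z\<in>D. A z) = UNIV"
      "\<And>z x t. z \<in> D \<Longrightarrow> x \<in> A z \<Longrightarrow> \<bar>F (x, t) - F (z, t)\<bar> \<le> e"
      using finite_partition[OF F e(1)] by blast
    have tot: "(\<Sum>z\<in>D. measure M (A z)) = ?m"
      using finite_measure_finite_Union[OF D(1) _ D(3)] D(2,4) by (simp add: sets_M image_subset_iff)
    \<comment> \<open>Symmetry moves the second variable into the first slot, where the partition
      controls \<open>F\<close>; thus one partition serves both variables.\<close>
    have "\<bar>(\<Sum>z\<in>D. measure M (A z) * (\<integral>t. F (z, t) \<partial>M)) - (\<Sum>z\<in>D. \<Sum>z'\<in>D. measure M (A z) * measure M (A z') * F (z, z'))\<bar>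
      = \<bar>\<Sum>z\<in>D. measure M (A z) * ((\<integral>t. F (t, z) \<partial>M) - (\<Sum>z'\<in>D. measure M (A z') * F (z', z)))\<bar>"
      by (simp add: sum_subtractf right_diff_distrib sum_distrib_left mult.assoc sym[of _ "_::'a"])
    also have "\<dots> \<le> (\<Sum>z\<in>D. measure M (A z) * (e * ?m))"
      by (rule order_trans[OF sum_abs] sum_mono)+ (auto simp: abs_mult intro!: mult_left_mono integral_partition[OF F D])
    also have "\<dots> = e * ?m * ?m" by (simp add: sum_distrib_right[symmetric] tot)
    finally show ?thesis
      using integral_partition_iterated(2)[OF F D] e(2) pos[OF D(1), of "\<lambda>z. measure M (A z)"]
      by (simp add: algebra_simps)
  qed
  then show ?thesis using field_le_epsilon[of 0] by blast
qed

section \<open>Real-valued convolution and the inner product\<close>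

definition rconv :: "('a \<Rightarrow> real) \<Rightarrow> ('a \<Rightarrow> real) \<Rightarrow> 'a \<Rightarrow> real" where
  "rconv u v x = (\<integral>y. u y * v (- y + x) \<partial>M)"

definition ip :: "('a \<Rightarrow> real) \<Rightarrow> ('a \<Rightarrow> real) \<Rightarrow> real" where
  "ip u v = (\<integral>x. u x * v x \<partial>M)"

lemma continuous_comp:
  assumes "continuous_on UNIV (v :: 'a \<Rightarrow> 'b::topological_space)" "continuous_on A g"
  shows "continuous_on A (\<lambda>p. v (g p))"
  by (rule continuous_on_compose2[OF assms(1)]) (auto intro!: assms)

lemma continuous_rconv:
  assumes "continuous_on UNIV u" "continuous_on UNIV v"
  shows "continuous_on UNIV (rconv u v)"
proof -
  have "continuous_on UNIV (\<lambda>p :: 'a \<times> 'a. u (snd p) * v (- snd p + fst p))"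
    by (intro assms[THEN continuous_comp] continuous_intros)
  from continuous_integral_kernel[OF this] show ?thesis
    by (simp add: rconv_def[abs_def])
qed

text \<open>Left invariance absorbs \<open>z\<close> into the inner variable; afterwards only the
  order of integration has to be exchanged.\<close>

lemma rconv_assoc:
  assumes u: "continuous_on UNIV u" and v: "continuous_on UNIV v" and w: "continuous_on UNIV w"
  shows "rconv u (rconv v w) = rconv (rconv u v) w"
proof
  fix x
  have inner: "rconv v w (- z + x) = (\<integral>y. v (- z + y) * w (- y + x) \<partial>M)" for z
  proof -
    have "continuous_on UNIV (\<lambda>y. v y * w (- y + (- z + x)))"
      by (intro v[THEN continuous_comp] w[THEN continuous_comp] continuous_intros)
    from integral_translate[OF measurable_continuous[OF this], of "- z"] show ?thesis
      by (simp add: rconv_def minus_add add.assoc[symmetric])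
  qed
  let ?F = "\<lambda>p. u (fst p) * (v (- fst p + snd p) * w (- snd p + x))"
  have F: "continuous_on UNIV ?F"
    by (intro u[THEN continuous_comp] v[THEN continuous_comp] w[THEN continuous_comp] continuous_intros)
  have "rconv u (rconv v w) x = (\<integral>z. \<integral>y. ?F (z, y) \<partial>M \<partial>M)"
    unfolding rconv_def[of u "rconv v w"] inner by simp
  also have "\<dots> = (\<integral>y. \<integral>z. ?F (z, y) \<partial>M \<partial>M)"
    by (rule fubini_continuous[OF F])
  also have "\<dots> = (\<integral>y. rconv u v y * w (- y + x) \<partial>M)"
    unfolding rconv_def by (simp add: mult.assoc[symmetric])
  finally show "rconv u (rconv v w) x = rconv (rconv u v) w x"
    by (simp add: rconv_def)
qed

lemma rconv_add_left:
  assumes "continuous_on UNIV u" "continuous_on UNIV v" "continuous_on UNIV w"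
  shows "rconv (\<lambda>x. u x + v x) w = (\<lambda>x. rconv u w x + rconv v w x)"
proof
  fix x
  have "integrable M (\<lambda>y. u y * w (- y + x))" "integrable M (\<lambda>y. v y * w (- y + x))"
    by (intro integrable_continuous assms[THEN continuous_comp] continuous_intros)+
  then show "rconv (\<lambda>x. u x + v x) w x = rconv u w x + rconv v w x"
    by (simp add: rconv_def distrib_right)
qed

lemma rconv_add_right:
  assumes "continuous_on UNIV u" "continuous_on UNIV v" "continuous_on UNIV w"
  shows "rconv u (\<lambda>x. v x + w x) = (\<lambda>x. rconv u v x + rconv u w x)"
proof
  fix x
  have "integrable M (\<lambda>y. u y * v (- y + x))" "integrable M (\<lambda>y. u y * w (- y + x))"
    by (intro integrable_continuous assms[THEN continuous_comp] continuous_intros)+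
  then show "rconv u (\<lambda>x. v x + w x) x = rconv u v x + rconv u w x"
    by (simp add: rconv_def distrib_left)
qed

lemma rconv_scale_left: "rconv (\<lambda>x. c * u x) w = (\<lambda>x. c * rconv u w x)"
  by (simp add: rconv_def fun_eq_iff mult.assoc)

lemma rconv_scale_right: "rconv u (\<lambda>x. c * w x) = (\<lambda>x. c * rconv u w x)"
  by (simp add: rconv_def fun_eq_iff mult.left_commute)

lemma rconv_zero_left [simp]: "rconv (\<lambda>x. 0) w = (\<lambda>x. 0)"
  and rconv_zero_right [simp]: "rconv u (\<lambda>x. 0) = (\<lambda>x. 0)"
  by (simp_all add: rconv_def fun_eq_iff)

lemma ip_commute: "ip u v = ip v u"
  by (simp add: ip_def mult.commute)

lemma ip_zero [simp]: "ip (\<lambda>x. 0) v = 0" "ip u (\<lambda>x. 0) = 0"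
  by (simp_all add: ip_def)

lemma ip_add_left:
  assumes "continuous_on UNIV u" "continuous_on UNIV v" "continuous_on UNIV w"
  shows "ip (\<lambda>x. u x + v x) w = ip u w + ip v w"
proof -
  have "integrable M (\<lambda>x. u x * w x)" "integrable M (\<lambda>x. v x * w x)"
    by (intro integrable_continuous continuous_intros assms)+
  then show ?thesis by (simp add: ip_def distrib_right)
qed

lemma ip_add_right:
  assumes "continuous_on UNIV u" "continuous_on UNIV v" "continuous_on UNIV w"
  shows "ip w (\<lambda>x. u x + v x) = ip w u + ip w v"
  using ip_add_left[OF assms] by (simp add: ip_commute)

lemma ip_scale_left: "ip (\<lambda>x. c * u x) w = c * ip u w"
  by (simp add: ip_def mult.assoc)

lemma ip_scale_right: "ip w (\<lambda>x. c * u x) = c * ip w u"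
  by (simp add: ip_def mult.left_commute)

lemma ip_self_nonneg: "ip u u \<ge> 0"
  by (simp add: ip_def)

text \<open>Brings the pairing into the kernel form \<open>v (- x + y)\<close>, the shape in which
  positive definiteness is stated.\<close>

lemma ip_rconv_eq:
  assumes "continuous_on UNIV u" "continuous_on UNIV v" "continuous_on UNIV w"
  shows "ip (rconv u v) w = (\<integral>x. \<integral>y. u x * w y * v (- x + y) \<partial>M \<partial>M)"
proof -
  let ?F = "\<lambda>p. u (fst p) * w (snd p) * v (- fst p + snd p)"
  have F: "continuous_on UNIV ?F"
    by (intro assms[THEN continuous_comp] continuous_intros)
  have "ip (rconv u v) w = (\<integral>y. \<integral>x. ?F (x, y) \<partial>M \<partial>M)"
  proof -
    have "rconv u v y * w y = (\<integral>x. ?F (x, y) \<partial>M)" for y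
      unfolding rconv_def by (subst integral_mult_left_zero[symmetric]) (simp add: ac_simps)
    then show ?thesis by (simp add: ip_def)
  qed
  also have "\<dots> = (\<integral>x. \<integral>y. ?F (x, y) \<partial>M \<partial>M)"
    by (rule fubini_continuous[OF F, symmetric])
  finally show ?thesis by simp
qed

text \<open>A compact Hausdorff space is normal, so Urysohn's lemma separates \<open>x\<close> from
  the complement of \<open>U\<close>.\<close>

lemma bump_function:
  assumes "open (U :: 'a set)" "x \<in> U"
  obtains \<phi> :: "'a \<Rightarrow> real" where "continuous_on UNIV \<phi>" "\<And>y. \<phi> y \<in> {0..1}" "\<phi> x = 1"
    "\<And>y. y \<notin> U \<Longrightarrow> \<phi> y = 0"
proof -
  have "Hausdorff_space (euclidean :: 'a topology)"
    unfolding Hausdorff_space_def disjnt_def open_openin[symmetric] by (metis hausdorff)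
  then have "normal_space (euclidean :: 'a topology)"
    using compact_UNIV by (intro compact_Hausdorff_or_regular_imp_normal_space) (auto simp: compact_space_def)
  moreover have "closedin euclidean (- U)" "closedin euclidean {x}" "disjnt (- U) {x}"
    using assms by auto
  ultimately obtain \<phi> where \<phi>: "continuous_map euclidean (top_of_set {0..1::real}) \<phi>"
    "\<phi> ` (- U) \<subseteq> {0}" "\<phi> ` {x} \<subseteq> {1}"
    using Urysohn_lemma[of euclidean "- U" "{x}" 0 1] by auto
  have "continuous_on UNIV \<phi>" "\<And>y. \<phi> y \<in> {0..1}"
    using \<phi>(1) by (auto simp: continuous_map_in_subtopology)
  then show ?thesis using that[of \<phi>] \<phi> by auto
qed

end

section \<open>The convolution operator of a positive definite function\<close>

locale pd_function = compact_haar M for M :: "'a::{topological_group_add,t2_space} measure" +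
  fixes f :: "'a \<Rightarrow> real"
  assumes continuous_f [simp]: "continuous_on UNIV f"
    and pd_f: "positive_definite (\<lambda>x. complex_of_real (f x))"
    and bound_f: "f 0 * measure M UNIV \<le> 1"
begin

text \<open>Positive definiteness at the points 0 and \<open>x\<close> with coefficients 1 and
  \<open>c\<close>. The imaginary part for \<open>c = \<i>\<close> gives the symmetry of
  \<open>f\<close>; the values 1 and -1 of \<open>c\<close> give
  \<open>\<bar>f x\<bar> \<le> f 0\<close>.\<close>

lemma pd_two:
  "2 * complex_of_real (f 0) + cnj c * complex_of_real (f x) + c * complex_of_real (f (- x)) \<in> \<real>\<^sub>\<ge>\<^sub>0"
  if "c * cnj c = 1"
  using pd_f[unfolded positive_definite_def, rule_format,
      where n = 2 and c = "\<lambda>i. if i = 0 then 1 else c" and x = "\<lambda>i. if i = 0 then 0 else x"] that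
  by (simp add: numeral_2_eq_2 add_ac)

lemma f_minus: "f (- x) = f x"
  using pd_two[of \<i> x] by (simp add: complex_nonneg_Reals_iff)

lemma abs_f_le: "\<bar>f x\<bar> \<le> f 0"
  using pd_two[of 1 x] pd_two[of "-1" x] by (simp add: complex_nonneg_Reals_iff f_minus)

lemma f_diff_commute: "f (- x + y) = f (- y + x)"
  using f_minus[of "- x + y"] by (simp add: minus_add)

lemma pd_finite:
  fixes w :: "'a \<Rightarrow> real"
  assumes "finite D"
  shows "(\<Sum>z\<in>D. \<Sum>z'\<in>D. w z * w z' * f (- z + z')) \<ge> 0"
proof -
  obtain h where h: "bij_betw h {0..<card D} D" using ex_bij_betw_nat_finite[OF assms] by blast
  have "(\<Sum>z\<in>D. \<Sum>z'\<in>D. w z * w z' * f (- z + z'))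
      = (\<Sum>i<card D. \<Sum>j<card D. w (h i) * w (h j) * f (- h i + h j))"
    using h by (simp add: sum.reindex_bij_betw[OF h, symmetric] lessThan_atLeast0)
  moreover have "complex_of_real (\<Sum>i<card D. \<Sum>j<card D. w (h i) * w (h j) * f (- h i + h j)) \<in> \<real>\<^sub>\<ge>\<^sub>0"
    using pd_f[unfolded positive_definite_def, rule_format,
        where n = "card D" and c = "\<lambda>i. complex_of_real (w (h i))" and x = h] by simp
  ultimately show ?thesis by (simp only: nonneg_Reals_of_real_iff)
qed

text \<open>With \<open>f\<close> on the right, associativity makes \<open>T\<close> commute with
  convolution from the left, which \<open>rconv_act\<close> exploits.\<close>

abbreviation T :: "('a \<Rightarrow> real) \<Rightarrow> 'a \<Rightarrow> real" where
  "T u \<equiv> rconv u f"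

text \<open>The kernel \<open>f (- x + y)\<close> of \<open>T\<close> is symmetric by
  \<open>f_minus\<close>.\<close>

lemma ip_T_commute:
  assumes "continuous_on UNIV u" "continuous_on UNIV v"
  shows "ip (T u) v = ip u (T v)"
proof -
  have "ip (T u) v = (\<integral>x. u x * (\<integral>y. v y * f (- y + x) \<partial>M) \<partial>M)"
    unfolding ip_rconv_eq[OF assms(1) continuous_f assms(2)]
    by (simp add: f_diff_commute[of _ "_ :: 'a"] mult.assoc flip: integral_mult_right_zero)
  then show ?thesis by (simp add: ip_def rconv_def)
qed

text \<open>The values of \<open>u\<close> are absorbed into the weights of
  \<open>pd_finite\<close>, and the finite inequality passes to the integral.\<close>

lemma ip_T_nonneg:
  assumes u: "continuous_on UNIV u"
  shows "ip (T u) u \<ge> 0"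
proof -
  let ?F = "\<lambda>p. u (fst p) * u (snd p) * f (- fst p + snd p)"
  have F: "continuous_on UNIV ?F"
    by (intro u[THEN continuous_comp] continuous_f[THEN continuous_comp] continuous_intros)
  have "(\<integral>x. \<integral>y. ?F (x, y) \<partial>M \<partial>M) \<ge> 0"
  proof (rule symmetric_kernel_nonneg[OF F])
    show "?F (x, y) = ?F (y, x)" for x y
      using f_diff_commute[of x y] by simp
    show "(\<Sum>z\<in>D. \<Sum>z'\<in>D. w z * w z' * ?F (z, z')) \<ge> 0" if "finite D" for D w
      using pd_finite[OF that, of "\<lambda>z. w z * u z"] by (simp add: ac_simps)
  qed
  then show ?thesis by (simp add: ip_rconv_eq u)
qed

text \<open>The integrand is at most \<open>f 0 / 2 * (u x * u x + u y * u y)\<close>; integrating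
  gives \<open>f 0 * measure M UNIV * ip u u\<close>, and \<open>bound_f\<close> makes the constant
  at most 1.\<close>

lemma ip_T_le:
  assumes u: "continuous_on UNIV u"
  shows "ip (T u) u \<le> ip u u"
proof -
  let ?m = "measure M UNIV"
  have u2: "integrable M (\<lambda>x. u x * u x)"
    by (intro integrable_continuous continuous_intros u)
  have le: "u x * u y * f (- x + y) \<le> f 0 / 2 * (u x * u x + u y * u y)" for x y
  proof -
    have "u x * u y * f (- x + y) \<le> \<bar>u x * u y\<bar> * f 0"
      using abs_f_le[of "- x + y"] by (metis abs_ge_self abs_ge_zero abs_mult mult_left_mono order_trans)
    also have "2 * \<bar>u x * u y\<bar> \<le> u x * u x + u y * u y"
      using sum_squares_bound[of "\<bar>u x\<bar>" "\<bar>u y\<bar>"] by (simp add: abs_mult power2_eq_square)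
    then have "\<bar>u x * u y\<bar> * f 0 \<le> (u x * u x + u y * u y) / 2 * f 0"
      using abs_f_le[of 0] by (intro mult_right_mono) auto
    finally show ?thesis by (simp add: mult.commute)
  qed
  have row: "(\<integral>y. u x * u y * f (- x + y) \<partial>M) \<le> f 0 / 2 * (?m * (u x * u x) + ip u u)" for x
  proof -
    have "(\<integral>y. u x * u y * f (- x + y) \<partial>M) \<le> (\<integral>y. f 0 / 2 * (u x * u x + u y * u y) \<partial>M)"
      using le u2 by (intro integral_mono integrable_continuous u[THEN continuous_comp] continuous_f[THEN continuous_comp] continuous_intros) auto
    then show ?thesis using u2 by (simp add: ip_def algebra_simps)
  qed
  have "(\<integral>x. \<integral>y. u x * u y * f (- x + y) \<partial>M \<partial>M) \<le> (\<integral>x. f 0 / 2 * (?m * (u x * u x) + ip u u) \<partial>M)"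
  proof (intro integral_mono row)
    have "continuous_on UNIV (\<lambda>p :: 'a \<times> 'a. u (fst p) * u (snd p) * f (- fst p + snd p))"
      by (intro u[THEN continuous_comp] continuous_f[THEN continuous_comp] continuous_intros)
    from integrable_continuous[OF continuous_integral_kernel[OF this]]
    show "integrable M (\<lambda>x. \<integral>y. u x * u y * f (- x + y) \<partial>M)" by simp
    show "integrable M (\<lambda>x. f 0 / 2 * (?m * (u x * u x) + ip u u))" using u2 by simp
  qed
  also have "\<dots> = f 0 * ?m * ip u u" 
    by (subst integral_mult_right_zero, subst Bochner_Integration.integral_add) (use u2 in \<open>auto simp: ip_def\<close>)
  also have "\<dots> \<le> 1 * ip u u" by (intro mult_right_mono bound_f ip_self_nonneg)
  finally show ?thesis by (simp add: ip_rconv_eq u)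
qed

section \<open>Polynomials in the operator\<close>

text \<open>\<open>act p u\<close> is \<open>p(T) u\<close>.\<close>

definition act :: "real poly \<Rightarrow> ('a \<Rightarrow> real) \<Rightarrow> 'a \<Rightarrow> real" where
  "act p u = fold_coeffs (\<lambda>c v x. c * u x + T v x) p (\<lambda>x. 0)"

lemma act_0 [simp]: "act 0 u = (\<lambda>x. 0)"
  by (simp add: act_def)

lemma act_pCons [simp]: "act (pCons c p) u = (\<lambda>x. c * u x + T (act p u) x)"
  \<comment> \<open>The zero polynomial is also \<open>pCons 0 0\<close>, on which
    \<open>fold_coeffs\<close> performs no step; the equation then holds because \<open>T\<close>
    maps 0 to 0.\<close>
  by (cases "p = 0 \<and> c = 0") (auto simp: act_def fun_eq_iff)

lemma continuous_act [simp]: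
  assumes "continuous_on UNIV u"
  shows "continuous_on UNIV (act p u)"
  by (induction p) (auto intro!: continuous_intros continuous_rconv assms)

lemma continuous_T [simp]: "continuous_on UNIV u \<Longrightarrow> continuous_on UNIV (T u)"
  by (intro continuous_rconv continuous_f)

lemma T_add:
  assumes "continuous_on UNIV u" "continuous_on UNIV v"
  shows "T (\<lambda>x. u x + v x) = (\<lambda>x. T u x + T v x)"
  by (intro rconv_add_left assms continuous_f)

lemma T_scale: "T (\<lambda>x. c * u x) = (\<lambda>x. c * T u x)"
  by (rule rconv_scale_left)

lemma continuous_scale [simp]:
  "continuous_on UNIV (u :: 'a \<Rightarrow> real) \<Longrightarrow> continuous_on UNIV (\<lambda>x. c * u x)"
  by (intro continuous_intros)

lemma act_add:
  assumes u: "continuous_on UNIV u"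
  shows "act (p + q) u = (\<lambda>x. act p u x + act q u x)"
proof (induction p q rule: poly_induct2)
  case (pCons a p b q)
  then show ?case
    by (simp add: T_add u distrib_right add_ac)
qed simp

lemma act_smult: "act (smult c p) u = (\<lambda>x. c * act p u x)"
  by (induction p) (simp_all add: T_scale distrib_left mult.assoc)

lemma act_diff:
  assumes "continuous_on UNIV u"
  shows "act (p - q) u = (\<lambda>x. act p u x - act q u x)"
  using act_add[OF assms, of p "- q"] act_smult[of "-1" q u] by simp

lemma act_T:
  assumes u: "continuous_on UNIV u"
  shows "act p (T u) = T (act p u)"
  by (induction p) (simp_all add: T_add T_scale u)

lemma act_mult:
  assumes u: "continuous_on UNIV u"
  shows "act (p * q) u = act p (act q u)"
  by (induction p) (simp_all add: act_add act_smult u)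

lemma act_1 [simp]: "act 1 u = u"
  by (simp add: one_pCons)

lemma ip_act_commute:
  assumes u: "continuous_on UNIV u" and v: "continuous_on UNIV v"
  shows "ip (act p u) v = ip u (act p v)"
  using v
proof (induction p arbitrary: v)
  case (pCons a p)
  have "ip (T (act p u)) v = ip u (T (act p v))"
    using pCons.IH[of "T v"] by (simp add: ip_T_commute act_T u pCons.prems)
  then show ?case
    by (simp add: ip_add_left ip_add_right ip_scale_left ip_scale_right u pCons.prems)
qed simp

section \<open>A cone of polynomials acting as positive operators\<close>

text \<open>The cone of polynomials generated by the products \<open>t\<^sup>i (1 - t)\<^sup>j\<close>; since \<open>0 \<le> T \<le> 1\<close>, they act as
  positive operators.\<close>

inductive_set cone :: "real poly set" where
  const: "c \<ge> 0 \<Longrightarrow> [:c:] \<in> cone"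
| t_mult: "p \<in> cone \<Longrightarrow> [:0, 1:] * p \<in> cone"
| one_minus_t_mult: "p \<in> cone \<Longrightarrow> [:1, -1:] * p \<in> cone"
| add: "p \<in> cone \<Longrightarrow> q \<in> cone \<Longrightarrow> p + q \<in> cone"

lemma cone_smult:
  assumes "p \<in> cone" "c \<ge> 0"
  shows "smult c p \<in> cone"
  using assms(1)
proof induction
  case (const d)
  then show ?case using assms(2) by (auto intro: cone.const)
next
  case (add p q)
  then show ?case by (simp add: smult_add_right cone.add)
qed (metis mult_smult_right cone.intros)+

lemma cone_mult:
  assumes "p \<in> cone" "q \<in> cone"
  shows "p * q \<in> cone"
  using assms(1)
proof induction
  case (const c)
  then show ?case using cone_smult[OF assms(2), of c] by simp
next
  case (add p q)
  then show ?case by (simp add: distrib_right cone.add)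
qed (metis mult.assoc cone.intros)+

lemma cone_t: "[:0, 1:] \<in> cone"
  using cone.t_mult[OF cone.const[of 1]] by simp

lemma act_t_mult: "continuous_on UNIV u \<Longrightarrow> act ([:0, 1:] * p) u = T (act p u)"
  by (simp add: act_mult)

definition positive_poly :: "real poly \<Rightarrow> bool" where
  "positive_poly p \<longleftrightarrow> (\<forall>u. continuous_on UNIV u \<longrightarrow> ip (act p u) u \<ge> 0)"

lemma positive_poly_add:
  "positive_poly p \<Longrightarrow> positive_poly q \<Longrightarrow> positive_poly (p + q)"
  by (simp add: positive_poly_def act_add ip_add_left)

lemma positive_poly_smult:
  "positive_poly p \<Longrightarrow> c \<ge> 0 \<Longrightarrow> positive_poly (smult c p)"
  by (simp add: positive_poly_def act_smult ip_scale_left)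

text \<open>As \<open>act q\<close> is self-adjoint, one factor \<open>q\<close> moves to the other
  side and leaves \<open>act p\<close> tested on \<open>act q u\<close>.\<close>

lemma positive_poly_square_mult:
  assumes "positive_poly p"
  shows "positive_poly (q * q * p)"
  unfolding positive_poly_def
proof (intro allI impI)
  fix u :: "'a \<Rightarrow> real" assume u: "continuous_on UNIV u"
  have "ip (act (q * q * p) u) u = ip (act p (act q u)) (act q u)"
    using ip_act_commute[of "act (q * p) u" u q] u by (simp add: act_mult[symmetric] mult_ac)
  then show "ip (act (q * q * p) u) u \<ge> 0"
    using assms u by (simp add: positive_poly_def)
qed

lemma positive_poly_one: "positive_poly 1"
  by (simp add: positive_poly_def ip_self_nonneg)

lemma positive_poly_t: "positive_poly [:0, 1:]"
  by (simp add: positive_poly_def ip_T_nonneg)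

lemma positive_poly_one_minus_t: "positive_poly [:1, -1:]"
  unfolding positive_poly_def
proof (intro allI impI)
  fix u :: "'a \<Rightarrow> real" assume u: "continuous_on UNIV u"
  have "act [:1, -1:] u = (\<lambda>x. u x + (-1) * T u x)"
    by (simp add: T_scale[of "-1", simplified])
  then show "ip (act [:1, -1:] u) u \<ge> 0"
    using ip_T_le[OF u] u by (simp only: ip_add_left ip_scale_left continuous_scale continuous_T)
qed

text \<open>\<open>t (1 - t) = (1 - t)\<^sup>2 t + t\<^sup>2 (1 - t)\<close>.\<close>

lemma positive_poly_t_one_minus_t: "positive_poly ([:0, 1:] * [:1, -1:])"
proof -
  have "[:0, 1:] * [:1, -1:] = [:1, -1:] * [:1, -1:] * [:0, 1:] + [:0, 1:] * [:0, 1:] * [:1, -1 :: real:]"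
    by simp
  then show ?thesis
    by (metis positive_poly_add positive_poly_square_mult positive_poly_t positive_poly_one_minus_t)
qed

text \<open>The induction carries four products at once: multiplying by \<open>t\<close> or
  \<open>1 - t\<close> permutes them up to square factors, which
  \<open>positive_poly_square_mult\<close> handles.\<close>

lemma cone_positive_aux:
  assumes "p \<in> cone"
  shows "positive_poly p \<and> positive_poly ([:0, 1:] * p) \<and> positive_poly ([:1, -1:] * p) \<and>
    positive_poly ([:0, 1:] * [:1, -1:] * p)"
  using assms
proof induction
  case (const c)
  have "[:c:] = smult c 1" "q * [:c:] = smult c q" for q by simp_all
  then show ?case
    by (metis const positive_poly_smult positive_poly_one positive_poly_t positive_poly_one_minus_t
        positive_poly_t_one_minus_t)
next
  case (t_mult p)
  have "[:0, 1:] * ([:0, 1:] * p) = [:0, 1:] * [:0, 1:] * p"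
    "[:1, -1:] * ([:0, 1:] * p) = [:0, 1:] * [:1, -1:] * p"
    "[:0, 1:] * [:1, -1:] * ([:0, 1:] * p) = [:0, 1:] * [:0, 1:] * ([:1, -1:] * p)"
    by (simp_all only: mult_ac)
  then show ?case using t_mult.IH positive_poly_square_mult by metis
next
  case (one_minus_t_mult p)
  have "[:1, -1:] * ([:1, -1:] * p) = [:1, -1:] * [:1, -1:] * p"
    "[:0, 1:] * ([:1, -1:] * p) = [:0, 1:] * [:1, -1:] * p"
    "[:0, 1:] * [:1, -1:] * ([:1, -1:] * p) = [:1, -1:] * [:1, -1:] * ([:0, 1:] * p)"
    by (simp_all only: mult_ac)
  then show ?case using one_minus_t_mult.IH positive_poly_square_mult by metis
next
  case (add p q)
  then show ?case by (simp only: distrib_left positive_poly_add)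
qed

lemma cone_positive: "p \<in> cone \<Longrightarrow> continuous_on UNIV u \<Longrightarrow> ip (act p u) u \<ge> 0"
  using cone_positive_aux by (auto simp: positive_poly_def)

section \<open>Convolutions of polynomial images of \<open>f\<close>\<close>

lemma rconv_act:
  assumes u: "continuous_on UNIV u" and v: "continuous_on UNIV v"
  shows "rconv u (act p v) = act p (rconv u v)"
proof (induction p)
  case (pCons a p)
  then show ?case
    by (simp add: rconv_add_right rconv_scale_right rconv_assoc u v)
qed simp

text \<open>The factor \<open>t\<close> comes from the \<open>f\<close> inside the second argument:
  \<open>rconv u (act q f)\<close> is \<open>act q (T u)\<close>.\<close>

lemma rconv_act_act: "rconv (act p f) (act q f) = act ([:0, 1:] * (p * q)) f"
proof -
  have "rconv (act p f) (act q f) = act q (T (act p f))" by (simp add: rconv_act)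
  also have "\<dots> = T (act (q * p) f)" by (simp add: act_T act_mult)
  finally show ?thesis by (simp only: act_t_mult[OF continuous_f] mult.commute[of p q])
qed

text \<open>After a translation, \<open>T (act p f)\<close> at \<open>- x\<close> becomes
  \<open>rconv f (act p f)\<close> at \<open>x\<close>, since \<open>act p f\<close> is even by
  induction. The two factors may be swapped, because either order is \<open>act p\<close> applied to
  \<open>T f\<close>.\<close>

lemma act_f_minus: "act p f (- x) = act p f x"
proof (induction p arbitrary: x)
  case (pCons a p)
  let ?v = "act p f"
  have "T ?v (- x) = (\<integral>y. ?v y * f (x + y) \<partial>M)"
    unfolding rconv_def using f_minus[of "x + _"] by (simp add: minus_add)
  also have "\<dots> = (\<integral>y. ?v (- x + y) * f y \<partial>M)"
  proof -
    have "continuous_on UNIV (\<lambda>y. ?v y * f (x + y))"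
      by (intro continuous_f[THEN continuous_comp] continuous_act continuous_f continuous_intros)
    from integral_translate[OF measurable_continuous[OF this], of "- x"] show ?thesis
      by (simp add: add.assoc[symmetric])
  qed
  also have "\<dots> = rconv f ?v x"
    unfolding rconv_def using pCons.IH[of "- x + _"] by (simp add: minus_add mult.commute)
  also have "\<dots> = T ?v x" by (simp add: rconv_act act_T)
  finally show ?case by (simp add: f_minus)
qed simp

text \<open>For an even second factor the inner product is the convolution evaluated at 0.\<close>

lemma ip_act_act: "ip (act p f) (act q f) = act ([:0, 1:] * (p * q)) f 0"
  unfolding rconv_act_act[symmetric] by (simp add: rconv_def ip_def act_f_minus)

text \<open>Positivity of the operator is localised at 0. If \<open>h = act s f\<close> were
  negative at 0, the pairing of \<open>rconv \<phi> h\<close> with \<open>\<phi>\<close>, for a bump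
  \<open>\<phi>\<close> concentrated near 0, would be at most \<open>- e\<close> times the squared
  integral of \<open>\<phi>\<close>, yet it is nonnegative.\<close>

lemma act_cone_at_zero:
  assumes s: "s \<in> cone"
  shows "act s f 0 \<ge> 0"
proof (rule ccontr)
  define h where "h = act s f"
  define e where "e = - h 0 / 2"
  assume "\<not> act s f 0 \<ge> 0"
  then have e: "e > 0" "h 0 < - e" by (simp_all add: e_def h_def)
  have h: "continuous_on UNIV h" by (simp add: h_def)
  let ?P = "{p. h (- fst p + snd p) < - e}"
  have "open ?P"
    by (intro open_Collect_less continuous_intros h[THEN continuous_comp])
  moreover have "(0, 0) \<in> ?P" using e by simp
  ultimately obtain U V where UV: "open U" "open V" "0 \<in> U" "0 \<in> V" "U \<times> V \<subseteq> ?P"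
    by (rule open_prod_elim) (auto simp del: mem_Collect_eq)
  obtain \<phi> :: "'a \<Rightarrow> real" where \<phi>: "continuous_on UNIV \<phi>" "\<And>y. \<phi> y \<in> {0..1}" "\<phi> 0 = 1"
    "\<And>y. y \<notin> U \<inter> V \<Longrightarrow> \<phi> y = 0"
    using bump_function[of "U \<inter> V" 0] UV by auto
  have neg: "\<phi> x * \<phi> y * h (- x + y) \<le> - e * (\<phi> x * \<phi> y)" for x y
  proof (cases "x \<in> U \<and> y \<in> V")
    case True
    then have "h (- x + y) \<le> - e" using UV(5) by force
    moreover have "\<phi> x * \<phi> y \<ge> 0" using \<phi>(2)[of x] \<phi>(2)[of y] by simp
    ultimately have "\<phi> x * \<phi> y * h (- x + y) \<le> \<phi> x * \<phi> y * (- e)" by (intro mult_left_mono)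
    then show ?thesis by (simp add: mult_ac)
  next
    case False
    then have "\<phi> x = 0 \<or> \<phi> y = 0" using \<phi>(4) by auto
    then show ?thesis by auto
  qed
  \<comment> \<open>The convolution is \<open>act\<close> of \<open>t * s\<close> on
    \<open>\<phi>\<close>, and \<open>t * s\<close> is again in the cone.\<close>
  have "rconv \<phi> h = T (act s \<phi>)" unfolding h_def by (simp add: rconv_act act_T \<phi>(1))
  then have "0 \<le> ip (rconv \<phi> h) \<phi>"
    using cone_positive[OF cone.t_mult[OF s] \<phi>(1)] by (simp only: act_t_mult[OF \<phi>(1)])
  also have "\<dots> = (\<integral>x. \<integral>y. \<phi> x * \<phi> y * h (- x + y) \<partial>M \<partial>M)"
    by (rule ip_rconv_eq[OF \<phi>(1) h \<phi>(1)])
  also have "\<dots> \<le> (\<integral>x. \<integral>y. - e * (\<phi> x * \<phi> y) \<partial>M \<partial>M)"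
  proof (intro integral_mono)
    have "continuous_on UNIV (\<lambda>p. \<phi> (fst p) * \<phi> (snd p) * h (- fst p + snd p))"
      by (intro h[THEN continuous_comp] \<phi>(1)[THEN continuous_comp] continuous_intros)
    from integrable_continuous[OF continuous_integral_kernel[OF this]]
    show "integrable M (\<lambda>x. \<integral>y. \<phi> x * \<phi> y * h (- x + y) \<partial>M)" by simp
    show "integrable M (\<lambda>x. \<integral>y. - e * (\<phi> x * \<phi> y) \<partial>M)"
      using integrable_continuous[OF \<phi>(1)] by simp
    show "integrable M (\<lambda>y. \<phi> x * \<phi> y * h (- x + y))" for x
      by (intro integrable_continuous h[THEN continuous_comp] \<phi>(1)[THEN continuous_comp] continuous_intros)
    show "integrable M (\<lambda>y. - e * (\<phi> x * \<phi> y))" for x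
      using integrable_continuous[OF \<phi>(1)] by simp
  qed (rule neg)
  also have "\<dots> = - e * (\<integral>x. \<phi> x \<partial>M)\<^sup>2"
    by (simp add: power2_eq_square)
  finally have 0: "(\<integral>x. \<phi> x \<partial>M) = 0"
    using e(1) by (simp add: mult_le_0_iff)
  \<comment> \<open>Since \<open>\<phi>\<close> takes values in \<open>{0..1}\<close>, its square
    also integrates to 0, which contradicts \<open>\<phi> 0 = 1\<close>.\<close>
  have "(\<integral>x. (\<phi> x)\<^sup>2 \<partial>M) \<le> (\<integral>x. \<phi> x \<partial>M)"
    using \<phi>(2) by (intro integral_mono integrable_continuous continuous_intros \<phi>(1))
      (simp add: power2_eq_square mult_left_le)
  then have "(\<integral>x. (\<phi> x)\<^sup>2 \<partial>M) = 0" using 0 by (simp add: antisym)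
  from continuous_eq_0[OF \<phi>(1) this, of 0] \<phi>(3) show False by simp
qed

section \<open>Approximating the inverse square root\<close>

text \<open>On \<open>(0, 1]\<close> these polynomials increase to \<open>1 / sqrt t\<close>.\<close>

fun isq :: "nat \<Rightarrow> real poly" where
  "isq 0 = 0"
| "isq (Suc n) = isq n + [:1/2:] * (1 - [:0, 1:] * isq n * isq n)"

text \<open>Here \<open>h\<close> stands for 1/2. The right-hand sides are built by sums and
  products from \<open>h\<close>, \<open>t\<close>, \<open>1 - t\<close>, \<open>1 - t * r\<close>,
  \<open>d\<close> and \<open>1 - t * r'\<close>, so cone membership passes from \<open>r\<close> to
  \<open>r'\<close>.\<close>

lemma isq_step_identities:
  fixes t r h :: "'b::comm_ring_1"
  assumes h: "h + h = 1" and d: "d = 1 - t * r * r" and r': "r' = r + h * d"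
  shows "1 - t * r' = h * ((1 - t * r) * (1 - t * r) + (1 - t))"
    and "1 - t * r' * r' = d * ((1 - t * r') + h * h * (t * d))"
proof -
  have "h * ((1 - t * r) * (1 - t * r) + (1 - t)) = (h + h) * (1 - t * r) - t * (h * (1 - t * r * r))"
    by (simp add: algebra_simps)
  then show "1 - t * r' = h * ((1 - t * r) * (1 - t * r) + (1 - t))"
    unfolding h r' d by (simp add: algebra_simps)
  \<comment> \<open>Since \<open>h + h = 1\<close>, \<open>h\<close> is twice its square; this
    trades the coefficient \<open>- h * h\<close> of \<open>t * d * d\<close> for
    \<open>- h + h * h\<close>.\<close>
  have hh: "h * x = h * h * x + h * h * x" for x
  proof -
    have "h * h * x + h * h * x = (h + h) * (h * x)" by (simp only: distrib_right mult.assoc)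
    then show ?thesis by (simp add: h)
  qed
  have "1 - t * r' * r' = (1 - t * r * r) - (h + h) * (t * r * d) - h * h * (t * d * d)"
    unfolding r' by (simp add: algebra_simps)
  also have "\<dots> = d - t * r * d - h * (t * d * d) + h * h * (t * d * d)"
    unfolding h d[symmetric] using hh[of "t * d * d"] by simp
  also have "\<dots> = d * ((1 - t * r') + h * h * (t * d))"
    unfolding r' by (simp add: algebra_simps)
  finally show "1 - t * r' * r' = d * ((1 - t * r') + h * h * (t * d))" .
qed

text \<open>The second claim at \<open>Suc n\<close> combines the second at \<open>n\<close> with
  the first at \<open>Suc n\<close>.\<close>

lemma isq_cone_aux: "1 - [:0, 1:] * isq n \<in> cone \<and> 1 - [:0, 1:] * isq n * isq n \<in> cone"
proof (induction n)
  case 0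
  have "(1 :: real poly) \<in> cone" using cone.const[of 1] by (simp add: one_pCons)
  then show ?case by simp
next
  case (Suc n)
  let ?h = "[:1/2:] :: real poly" and ?t = "[:0, 1:] :: real poly"
  define d where "d = 1 - ?t * isq n * isq n"
  have h: "?h + ?h = 1" by (simp add: one_pCons)
  have hc: "?h \<in> cone" by (rule cone.const) simp
  have "1 - ?t = [:1, -1:]" by (simp add: one_pCons)
  then have tc: "1 - ?t \<in> cone" using cone.one_minus_t_mult[OF cone.const[of 1]] by simp
  have r': "isq (Suc n) = isq n + ?h * d" by (simp add: d_def)
  have 1: "1 - ?t * isq (Suc n) \<in> cone"
    unfolding isq_step_identities(1)[OF h d_def r']
    using Suc by (intro cone_mult cone.add hc tc) auto
  moreover have "1 - ?t * isq (Suc n) * isq (Suc n) \<in> cone"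
    unfolding isq_step_identities(2)[OF h d_def r']
    using Suc by (intro cone_mult cone.add hc cone_t 1) (auto simp: d_def)
  ultimately show ?case by blast
qed

lemma isq_diff_cone: "m \<le> n \<Longrightarrow> isq n - isq m \<in> cone"
proof (induction n rule: dec_induct)
  case base
  show ?case using cone.const[of 0] by simp
next
  case (step n)
  have "[:1/2:] * (1 - [:0, 1:] * isq n * isq n) \<in> cone"
    using isq_cone_aux by (intro cone_mult cone.const) auto
  from cone.add[OF step.IH this] show ?case by (simp add: algebra_simps)
qed

lemma isq_cone: "isq n \<in> cone"
  using isq_diff_cone[of 0 n] by simp

definition approx :: "nat \<Rightarrow> 'a \<Rightarrow> real" where
  "approx n = act (isq n) f"

lemma continuous_approx [simp]: "continuous_on UNIV (approx n)"
  by (simp add: approx_def)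

lemma approx_diff: "(\<lambda>x. approx n x - approx m x) = act (isq n - isq m) f"
  by (simp add: approx_def act_diff)

text \<open>The recursion read through \<open>rconv_act_act\<close>: the left side is
  \<open>act\<close> of \<open>1 - t * r * r\<close> with \<open>r = isq n\<close>, which is twice
  the increment of \<open>isq\<close>. Thus the Cauchy property of \<open>approx\<close> will force
  the residual to 0.\<close>

lemma residual: "f x - rconv (approx n) (approx n) x = 2 * (approx (Suc n) x - approx n x)"
proof -
  let ?p = "1 - [:0, 1:] * isq n * isq n"
  have "approx (Suc n) x - approx n x = act (isq (Suc n) - isq n) f x"
    using approx_diff[of "Suc n" n] by (rule fun_cong)
  also have "isq (Suc n) - isq n = smult (1/2) ?p"
    by simp
  also have "act \<dots> f x = 1/2 * act ?p f x"
    by (simp only: act_smult)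
  also have "act ?p f x = f x - rconv (approx n) (approx n) x"
    unfolding approx_def rconv_act_act by (simp only: act_diff[OF continuous_f] act_1 mult.assoc)
  finally show ?thesis by simp
qed

lemma ip_approx_le: "ip (approx n) (approx n) \<le> f 0"
proof -
  have "0 \<le> act (1 - [:0, 1:] * (isq n * isq n)) f 0"
    using isq_cone_aux[of n] by (intro act_cone_at_zero) (simp only: mult.assoc)
  also have "\<dots> = f 0 - ip (approx n) (approx n)"
    unfolding approx_def ip_act_act by (simp only: act_diff[OF continuous_f] act_1)
  finally show ?thesis by simp
qed

text \<open>Expanding the square leaves minus twice the pairing of \<open>approx m\<close> with the
  increment; that pairing is nonnegative because \<open>t * isq m * (isq n - isq m)\<close> lies in
  the cone.\<close>

lemma approx_diff_le:
  assumes "m \<le> n"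
  shows "(\<integral>x. (approx n x - approx m x)\<^sup>2 \<partial>M) \<le> ip (approx n) (approx n) - ip (approx m) (approx m)"
proof -
  let ?t = "[:0, 1:] :: real poly"
  let ?d = "isq n - isq m"
  have c: "?t * ([:2:] * (isq m * ?d)) \<in> cone"
    using isq_diff_cone[OF assms] by (intro cone_mult cone_t isq_cone cone.const) auto
  have "(\<integral>x. (approx n x - approx m x)\<^sup>2 \<partial>M) = ip (act ?d f) (act ?d f)"
    by (simp add: ip_def power2_eq_square approx_diff[THEN fun_cong, symmetric])
  also have "\<dots> = act (?t * (?d * ?d)) f 0" by (rule ip_act_act)
  also have "?t * (?d * ?d) = ?t * (isq n * isq n) - ?t * (isq m * isq m) - ?t * ([:2:] * (isq m * ?d))"
  proof -
    have "[:2:] = (2 :: real poly)" by (simp add: numeral_poly)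
    then show ?thesis by (simp only: algebra_simps mult_2) 
  qed
  also have "act \<dots> f 0 \<le> ip (approx n) (approx n) - ip (approx m) (approx m)"
    using act_cone_at_zero[OF c] unfolding approx_def ip_act_act
    by (simp only: act_diff[OF continuous_f]) 
  finally show ?thesis .
qed

end

section \<open>Square-integrable functions and completeness\<close>

definition sq_int :: "'a measure \<Rightarrow> ('a \<Rightarrow> real) \<Rightarrow> bool" where
  "sq_int M u \<longleftrightarrow> u \<in> borel_measurable M \<and> integrable M (\<lambda>x. (u x)\<^sup>2)"

lemma young_ineq:
  fixes a b s :: real
  assumes "s > 0"
  shows "\<bar>a * b\<bar> \<le> (a\<^sup>2 / s + s * b\<^sup>2) / 2"
proof -
  have "2 * \<bar>a\<bar> * (s * \<bar>b\<bar>) \<le> \<bar>a\<bar>\<^sup>2 + (s * \<bar>b\<bar>)\<^sup>2" by (rule sum_squares_bound)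
  then have "s * (2 * \<bar>a * b\<bar>) \<le> s * (a\<^sup>2 / s + s * b\<^sup>2)"
    using assms by (simp add: abs_mult power_mult_distrib algebra_simps power2_eq_square)
  then show ?thesis using assms by (simp only: mult_le_cancel_left_pos) simp
qed

lemma sq_int_mult:
  assumes u: "sq_int M u" and v: "sq_int M v"
  shows "integrable M (\<lambda>x. u x * v x)"
proof (rule Bochner_Integration.integrable_bound)
  show "integrable M (\<lambda>x. ((u x)\<^sup>2 / 1 + 1 * (v x)\<^sup>2) / 2)" using u v by (auto simp: sq_int_def)
  show "(\<lambda>x. u x * v x) \<in> borel_measurable M" using u v by (auto simp: sq_int_def)
  show "AE x in M. norm (u x * v x) \<le> norm (((u x)\<^sup>2 / 1 + 1 * (v x)\<^sup>2) / 2)"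
    using young_ineq[of 1] by (auto intro!: AE_I2 order_trans[OF _ abs_ge_self])
qed

text \<open>The free weight \<open>s\<close> takes the place of the square roots in the
  Cauchy-Schwarz inequality: it is fixed small against \<open>v\<close>, and then the norm of
  \<open>u\<close> may tend to 0.\<close>

lemma integral_abs_mult_le:
  assumes u: "sq_int M u" and v: "sq_int M v" and s: "s > 0"
  shows "(\<integral>x. \<bar>u x * v x\<bar> \<partial>M) \<le> ((\<integral>x. (u x)\<^sup>2 \<partial>M) / s + s * (\<integral>x. (v x)\<^sup>2 \<partial>M)) / 2"
proof -
  have "(\<integral>x. \<bar>u x * v x\<bar> \<partial>M) \<le> (\<integral>x. ((u x)\<^sup>2 / s + s * (v x)\<^sup>2) / 2 \<partial>M)"
    using u v s by (intro integral_mono young_ineq integrable_abs sq_int_mult) (auto simp: sq_int_def)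
  also have "\<dots> = ((\<integral>x. (u x)\<^sup>2 \<partial>M) / s + s * (\<integral>x. (v x)\<^sup>2 \<partial>M)) / 2"
    using u v by (simp add: sq_int_def)
  finally show ?thesis .
qed

lemma sq_int_diff:
  assumes u: "sq_int M u" and v: "sq_int M v"
  shows "sq_int M (\<lambda>x. u x - v x)"
proof -
  have "(\<lambda>x. (u x - v x)\<^sup>2) = (\<lambda>x. (u x)\<^sup>2 + (v x)\<^sup>2 - 2 * (u x * v x))"
    by (simp add: power2_diff mult.assoc)
  then show ?thesis using sq_int_mult[OF u v] u v unfolding sq_int_def by auto
qed

text \<open>Finite measure turns L2-Cauchy into L1-Cauchy, which yields a subsequence converging
  almost everywhere; Fatou's lemma brings the convergence back to L2. The limit is an explicit
  \<open>lim\<close>, so that pointwise identities of the sequence carry over at every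
  point.\<close>

lemma (in finite_measure) L2_cauchy_limit:
  fixes g :: "nat \<Rightarrow> 'a \<Rightarrow> real"
  assumes g: "\<And>n. sq_int M (g n)"
    and cauchy: "\<And>e. e > 0 \<Longrightarrow> \<exists>N. \<forall>i\<ge>N. \<forall>j\<ge>N. (\<integral>x. (g i x - g j x)\<^sup>2 \<partial>M) < e"
  obtains r where "strict_mono r" "sq_int M (\<lambda>x. lim (\<lambda>k. g (r k) x))"
    "(\<lambda>k. \<integral>x. (g (r k) x - lim (\<lambda>l. g (r l) x))\<^sup>2 \<partial>M) \<longlonglongrightarrow> 0"
proof -
  have one: "sq_int M (\<lambda>x. 1)" by (simp add: sq_int_def)
  have int: "integrable M (g n)" for n using sq_int_mult[OF g one] by simp
  have "\<exists>N. \<forall>i\<ge>N. \<forall>j\<ge>N. (\<integral>x. norm (g i x - g j x) \<partial>M) < e" if e: "e > 0" for e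
  proof -
    \<comment> \<open>The difference is paired with the constant 1: it contributes less than
      \<open>e\<close> after division by \<open>s\<close>, the constant at most \<open>e\<close>,
      and the average of the two is below \<open>e\<close>.\<close>
    obtain s where s: "s > 0" "s * measure M (space M) \<le> e"
      using small_multiple[OF e, of "measure M (space M)"] by auto
    have "e * s > 0" using e s by simp
    then obtain N where N: "\<forall>i\<ge>N. \<forall>j\<ge>N. (\<integral>x. (g i x - g j x)\<^sup>2 \<partial>M) < e * s"
      using cauchy by blast
    have "(\<integral>x. norm (g i x - g j x) \<partial>M) < e" if "i \<ge> N" "j \<ge> N" for i j
    proof -
      have "(\<integral>x. (g i x - g j x)\<^sup>2 \<partial>M) / s < e" using N that s by (simp add: field_simps)
      then show ?thesis
        using integral_abs_mult_le[OF sq_int_diff[OF g g] one s(1), of i j] s(2) by simp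
    qed
    then show ?thesis by blast
  qed
  then obtain r where r: "strict_mono r" "AE x in M. Cauchy (\<lambda>i. g (r i) x)"
    using cauchy_L1_AE_cauchy_subseq[of M g] int by blast
  define G where "G x = lim (\<lambda>k. g (r k) x)" for x
  have lim: "AE x in M. (\<lambda>k. g (r k) x) \<longlonglongrightarrow> G x"
    using r(2) by eventually_elim (simp add: G_def Cauchy_convergent convergent_LIMSEQ_iff[symmetric])
  have [measurable]: "g n \<in> borel_measurable M" for n using g by (simp add: sq_int_def)
  have [measurable]: "G \<in> borel_measurable M" unfolding G_def[abs_def] by measurable
  \<comment> \<open>With \<open>k\<close> fixed, Fatou's lemma is applied along the subsequence
    index \<open>l\<close>.\<close>
  have fatou: "(\<integral>\<^sup>+x. ennreal ((g (r k) x - G x)\<^sup>2) \<partial>M) \<le> ennreal e"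
    if N: "\<forall>i\<ge>N. \<forall>j\<ge>N. (\<integral>x. (g i x - g j x)\<^sup>2 \<partial>M) < e" and k: "k \<ge> N" for e N k
  proof -
    have "(\<integral>\<^sup>+x. ennreal ((g (r k) x - G x)\<^sup>2) \<partial>M)
        = (\<integral>\<^sup>+x. liminf (\<lambda>l. ennreal ((g (r k) x - g (r l) x)\<^sup>2)) \<partial>M)"
    proof (rule nn_integral_cong_AE)
      show "AE x in M. ennreal ((g (r k) x - G x)\<^sup>2) = liminf (\<lambda>l. ennreal ((g (r k) x - g (r l) x)\<^sup>2))"
        using lim
      proof eventually_elim
        case (elim x)
        then have "(\<lambda>l. ennreal ((g (r k) x - g (r l) x)\<^sup>2)) \<longlonglongrightarrow> ennreal ((g (r k) x - G x)\<^sup>2)"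
          by (intro tendsto_ennrealI tendsto_intros)
        then show ?case by (rule lim_imp_Liminf[symmetric, rotated]) simp
      qed
    qed
    also have "\<dots> \<le> liminf (\<lambda>l. \<integral>\<^sup>+x. ennreal ((g (r k) x - g (r l) x)\<^sup>2) \<partial>M)"
      by (rule nn_integral_liminf) simp
    also have "\<dots> \<le> liminf (\<lambda>l. ennreal e)"
    proof (rule Liminf_mono, rule eventually_sequentiallyI[of N])
      fix l assume "l \<ge> N"
      then have "(\<integral>x. (g (r k) x - g (r l) x)\<^sup>2 \<partial>M) \<le> e"
        using N k seq_suble[OF r(1), of k] seq_suble[OF r(1), of l] by (meson order_trans less_imp_le)
      moreover have "integrable M (\<lambda>x. (g (r k) x - g (r l) x)\<^sup>2)"
        using sq_int_diff[OF g g] by (simp add: sq_int_def)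
      ultimately show "(\<integral>\<^sup>+x. ennreal ((g (r k) x - g (r l) x)\<^sup>2) \<partial>M) \<le> ennreal e"
        by (simp add: nn_integral_eq_integral ennreal_leI)
    qed
    also have "\<dots> = ennreal e" by (simp add: Liminf_const)
    finally show ?thesis .
  qed
  obtain N1 where N1: "\<forall>i\<ge>N1. \<forall>j\<ge>N1. (\<integral>x. (g i x - g j x)\<^sup>2 \<partial>M) < 1" using cauchy[of 1] by auto
  \<comment> \<open>\<open>G\<close> is square integrable because it differs from one member of the
    sequence by a square-integrable function.\<close>
  have "sq_int M (\<lambda>x. g (r N1) x - G x)"
    using fatou[OF N1 order_refl] unfolding sq_int_def
    by (intro conjI integrableI_nonneg) (auto intro: le_less_trans)
  from sq_int_diff[OF g[of "r N1"] this] have G: "sq_int M G" by simp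
  have "(\<lambda>k. \<integral>x. (g (r k) x - G x)\<^sup>2 \<partial>M) \<longlonglongrightarrow> 0"
  proof (rule LIMSEQ_I)
    fix e :: real assume e: "e > 0"
    obtain N where N: "\<forall>i\<ge>N. \<forall>j\<ge>N. (\<integral>x. (g i x - g j x)\<^sup>2 \<partial>M) < e / 2" using cauchy[of "e / 2"] e by auto
    have "norm ((\<integral>x. (g (r k) x - G x)\<^sup>2 \<partial>M) - 0) < e" if "k \<ge> N" for k
    proof -
      have "integrable M (\<lambda>x. (g (r k) x - G x)\<^sup>2)"
        using sq_int_diff[OF g G] by (simp add: sq_int_def)
      then have "ennreal (\<integral>x. (g (r k) x - G x)\<^sup>2 \<partial>M) \<le> ennreal (e / 2)"
        using fatou[OF N that] by (simp add: nn_integral_eq_integral)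
      then have "(\<integral>x. (g (r k) x - G x)\<^sup>2 \<partial>M) \<le> e / 2" using e by (simp add: ennreal_le_iff)
      then show ?thesis using e by simp
    qed
    then show "\<exists>N. \<forall>k\<ge>N. norm ((\<integral>x. (g (r k) x - G x)\<^sup>2 \<partial>M) - 0) < e" by blast
  qed
  with G r(1) show ?thesis by (intro that[of r]) (simp_all add: G_def[abs_def])
qed

section \<open>Convolution of square-integrable functions\<close>

context compact_haar
begin

lemma sq_int_continuous: "continuous_on UNIV u \<Longrightarrow> sq_int M u"
  by (simp add: sq_int_def measurable_continuous integrable_continuous continuous_on_power)

text \<open>For even \<open>v\<close> the reflected \<open>v (- y + x)\<close> equals the left
  translate \<open>v (- x + y)\<close>, so left invariance suffices.\<close>

lemma sq_int_reflect:
  assumes v: "sq_int M v" and sym: "\<And>x. v (- x) = v x"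
  shows "sq_int M (\<lambda>y. v (- y + x))" "(\<integral>y. (v (- y + x))\<^sup>2 \<partial>M) = (\<integral>y. (v y)\<^sup>2 \<partial>M)"
proof -
  have eq: "v (- y + x) = v (- x + y)" for y
    using sym[of "- x + y"] by (simp add: minus_add)
  have [measurable]: "v \<in> borel_measurable M" using v by (simp add: sq_int_def)
  show "sq_int M (\<lambda>y. v (- y + x))"
    using v integrable_translate[of "\<lambda>y. (v y)\<^sup>2" "- x"] unfolding eq by (simp add: sq_int_def)
  show "(\<integral>y. (v (- y + x))\<^sup>2 \<partial>M) = (\<integral>y. (v y)\<^sup>2 \<partial>M)"
    unfolding eq by (rule integral_translate) simp
qed

text \<open>The difference is split by changing one factor at a time. By
  \<open>sq_int_reflect\<close> the bound is the same for every \<open>x\<close>.\<close>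

lemma rconv_diff_le:
  assumes u: "sq_int M u" and u': "sq_int M u'" and v: "sq_int M v" and v': "sq_int M v'"
    and sym: "\<And>x. v (- x) = v x" "\<And>x. v' (- x) = v' x" and s: "s > 0"
  shows "\<bar>rconv u v x - rconv u' v' x\<bar> \<le>
    ((\<integral>y. (u y - u' y)\<^sup>2 \<partial>M) / s + s * (\<integral>y. (v y)\<^sup>2 \<partial>M)) / 2 +
    ((\<integral>y. (v y - v' y)\<^sup>2 \<partial>M) / s + s * (\<integral>y. (u' y)\<^sup>2 \<partial>M)) / 2"
proof -
  note du = sq_int_diff[OF u u'] and dv = sq_int_diff[OF v v']
  note rv = sq_int_reflect[OF v sym(1), of x] sq_int_reflect[OF v' sym(2), of x]
  have rd: "sq_int M (\<lambda>y. v (- y + x) - v' (- y + x))"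
    "(\<integral>y. (v (- y + x) - v' (- y + x))\<^sup>2 \<partial>M) = (\<integral>y. (v y - v' y)\<^sup>2 \<partial>M)"
    using sq_int_reflect[OF dv, of x] sym by simp_all
  have "rconv u v x - rconv u' v' x = (\<integral>y. u y * v (- y + x) - u' y * v' (- y + x) \<partial>M)"
    unfolding rconv_def by (rule Bochner_Integration.integral_diff[symmetric]; intro sq_int_mult u u' rv)
  also have "\<dots> = (\<integral>y. (u y - u' y) * v (- y + x) + (v (- y + x) - v' (- y + x)) * u' y \<partial>M)"
    by (simp add: algebra_simps)
  finally have eq: "rconv u v x - rconv u' v' x =
      (\<integral>y. (u y - u' y) * v (- y + x) + (v (- y + x) - v' (- y + x)) * u' y \<partial>M)" .
  have "\<bar>rconv u v x - rconv u' v' x\<bar> \<le> (\<integral>y. \<bar>(u y - u' y) * v (- y + x)\<bar> \<partial>M) + (\<integral>y. \<bar>(v (- y + x) - v' (- y + x)) * u' y\<bar> \<partial>M)"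
    unfolding eq Bochner_Integration.integral_add[OF sq_int_mult[OF du rv(1)] sq_int_mult[OF rd(1) u']]
    by (rule order_trans[OF abs_triangle_ineq add_mono[OF integral_abs_bound integral_abs_bound]])
  also have "\<dots> \<le> ((\<integral>y. (u y - u' y)\<^sup>2 \<partial>M) / s + s * (\<integral>y. (v (- y + x))\<^sup>2 \<partial>M)) / 2 +
    ((\<integral>y. (v (- y + x) - v' (- y + x))\<^sup>2 \<partial>M) / s + s * (\<integral>y. (u' y)\<^sup>2 \<partial>M)) / 2"
    by (rule add_mono[OF integral_abs_mult_le[OF du rv(1) s] integral_abs_mult_le[OF rd(1) u' s]])
  finally show ?thesis by (simp only: rv(2) rd(2))
qed

text \<open>In \<open>rconv_diff_le\<close>, \<open>s\<close> is first fixed small against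
  \<open>C\<close> and the square integral of \<open>u\<close>; the terms divided by
  \<open>s\<close> then tend to 0, uniformly in \<open>x\<close>.\<close>

lemma rconv_uniform_limit:
  fixes U V :: "nat \<Rightarrow> 'a \<Rightarrow> real"
  assumes U: "\<And>k. sq_int M (U k)" "sq_int M u" "(\<lambda>k. \<integral>y. (U k y - u y)\<^sup>2 \<partial>M) \<longlonglongrightarrow> 0"
    and V: "\<And>k. sq_int M (V k)" "sq_int M v" "(\<lambda>k. \<integral>y. (V k y - v y)\<^sup>2 \<partial>M) \<longlonglongrightarrow> 0"
    and sym: "\<And>k x. V k (- x) = V k x" "\<And>x. v (- x) = v x"
    and C: "\<And>k. (\<integral>y. (V k y)\<^sup>2 \<partial>M) \<le> C"
  shows "uniform_limit UNIV (\<lambda>k. rconv (U k) (V k)) (rconv u v) sequentially"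
proof (rule uniform_limitI)
  fix e :: real assume e: "e > 0"
  let ?D = "C + (\<integral>y. (u y)\<^sup>2 \<partial>M)"
  have D: "?D \<ge> 0" using C[of 0] by (intro add_nonneg_nonneg) (auto intro: order_trans[rotated])
  obtain s where s: "s > 0" "s * ?D \<le> e" using small_multiple[OF e D] by blast
  have "(\<lambda>k. (\<integral>y. (U k y - u y)\<^sup>2 \<partial>M) / s + (\<integral>y. (V k y - v y)\<^sup>2 \<partial>M) / s) \<longlonglongrightarrow> 0 / s + 0 / s"
    using s by (intro tendsto_intros U(3) V(3)) auto
  then have small: "\<forall>\<^sub>F k in sequentially. (\<integral>y. (U k y - u y)\<^sup>2 \<partial>M) / s + (\<integral>y. (V k y - v y)\<^sup>2 \<partial>M) / s < e"
    using e by (intro order_tendstoD(2)[where y=0]) simp_all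
  have arith: "r < e" if "r \<le> (A + P) / 2 + (B + Q) / 2" "A + B < e" "P \<le> p" "p + Q \<le> e"
    for r A B P Q p :: real
    using that by argo
  show "\<forall>\<^sub>F k in sequentially. \<forall>x\<in>UNIV. dist (rconv (U k) (V k) x) (rconv u v x) < e"
    using small
  proof eventually_elim
    case (elim k)
    show ?case
    proof
      fix x
      have "s * (\<integral>y. (V k y)\<^sup>2 \<partial>M) \<le> s * C" using C s by (intro mult_left_mono) auto
      then show "dist (rconv (U k) (V k) x) (rconv u v x) < e"
        unfolding dist_real_def
        by (rule arith[OF rconv_diff_le[OF U(1,2) V(1,2) sym s(1)] elim _ s(2)[unfolded distrib_left]])
    qed
  qed
qed

lemma ip_uniform_limit:
  assumes a: "continuous_on UNIV a" and h: "\<And>k. continuous_on UNIV (h k)"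
    and lim: "uniform_limit UNIV h l sequentially"
  shows "(\<lambda>k. ip a (h k)) \<longlonglongrightarrow> ip a l"
proof -
  have l: "continuous_on UNIV l"
    using uniform_limit_theorem[OF _ lim] h by simp
  obtain B where B: "B \<ge> 0" "\<And>x. norm (a x) \<le> B" using continuous_bounded[OF a] by blast
  show ?thesis
  proof (rule metric_LIMSEQ_I)
    fix e :: real assume e: "e > 0"
    obtain d where d: "d > 0" "d * (B * measure M UNIV) \<le> e / 2"
      using small_multiple[of "e / 2" "B * measure M UNIV"] e B by auto
    obtain N where N: "\<forall>k\<ge>N. \<forall>x. \<bar>h k x - l x\<bar> < d"
      using uniform_limitD[OF lim d(1)] by (auto simp: eventually_sequentially dist_real_def)
    have "dist (ip a (h k)) (ip a l) < e" if k: "k \<ge> N" for k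
    proof -
      have "\<bar>ip a (h k) - ip a l\<bar> \<le> B * d * measure M UNIV"
        unfolding ip_def
      proof (rule integral_abs_diff_le)
        show "\<bar>a x * h k x - a x * l x\<bar> \<le> B * d" for x
        proof -
          have "\<bar>a x * h k x - a x * l x\<bar> = \<bar>a x\<bar> * \<bar>h k x - l x\<bar>" by (simp add: abs_mult flip: right_diff_distrib)
          also have "\<dots> \<le> B * d" using B N k by (intro mult_mono) (auto intro: less_imp_le)
          finally show ?thesis .
        qed
      qed (intro integrable_continuous continuous_intros a h l)+
      also have "\<dots> \<le> e / 2" using d(2) by (simp add: mult_ac)
      finally show ?thesis using e by (simp add: dist_real_def)
    qed
    then show "\<exists>N. \<forall>k\<ge>N. dist (ip a (h k)) (ip a l) < e" by blast
  qed
qed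

end

text \<open>For \<open>\<phi> = a + \<i> * b\<close> the real part is
  \<open>ip a (rconv a G) + ip b (rconv b G)\<close>, and \<open>comm\<close> cancels the imaginary
  part.\<close>

lemma (in compact_haar) positive_definite_L2_of_real:
  assumes G: "sq_int M G" and sym: "\<And>x. G (- x) = G x"
    and cont: "\<And>a. continuous_on UNIV a \<Longrightarrow> continuous_on UNIV (rconv a G)"
    and nonneg: "\<And>a. continuous_on UNIV a \<Longrightarrow> ip a (rconv a G) \<ge> 0"
    and comm: "\<And>a b. continuous_on UNIV a \<Longrightarrow> continuous_on UNIV b \<Longrightarrow> ip a (rconv b G) = ip b (rconv a G)"
  shows "positive_definite_L2 M (\<lambda>x. complex_of_real (G x))"
  unfolding positive_definite_L2_def
proof
  fix \<phi> :: "'a \<Rightarrow> complex" assume "\<phi> \<in> Cc"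
  then have \<phi>: "continuous_on UNIV \<phi>" by (simp add: Cc_def)
  define a b where "a x = Re (\<phi> x)" and "b x = Im (\<phi> x)" for x
  have ab: "continuous_on UNIV a" "continuous_on UNIV b"
    unfolding a_def[abs_def] b_def[abs_def] by (intro continuous_intros \<phi>)+
  have \<phi>_eq: "\<phi> x = of_real (a x) + \<i> * of_real (b x)" for x
    by (simp add: a_def b_def complex_eq)
  let ?A = "rconv a G" and ?B = "rconv b G"
  have row: "(\<integral>y. \<phi> x * cnj (\<phi> y) * of_real (G (- x + y)) \<partial>M) = \<phi> x * (of_real (?A x) - \<i> * of_real (?B x))" for x
  proof -
    have int: "integrable M (\<lambda>y. u y * G (- y + x))" if "continuous_on UNIV u" for u
      by (intro sq_int_mult sq_int_continuous that sq_int_reflect G sym)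
    have "G (- x + y) = G (- y + x)" for y using sym[of "- x + y"] by (simp add: minus_add)
    then have "(\<integral>y. \<phi> x * cnj (\<phi> y) * of_real (G (- x + y)) \<partial>M) =
        (\<integral>y. \<phi> x * (of_real (a y * G (- y + x)) - \<i> * of_real (b y * G (- y + x))) \<partial>M)"
      by (intro Bochner_Integration.integral_cong) (simp_all add: \<phi>_eq algebra_simps)
    also have "\<dots> = \<phi> x * ((\<integral>y. complex_of_real (a y * G (- y + x)) \<partial>M) -
        \<i> * (\<integral>y. complex_of_real (b y * G (- y + x)) \<partial>M))"
      using int[OF ab(1)] int[OF ab(2)]
      by (simp add: integrable_of_real Bochner_Integration.integral_diff del: of_real_mult)
    finally show ?thesis by (simp add: rconv_def del: of_real_mult)
  qed
  have int: "integrable M (\<lambda>x. u x * v x)" if "continuous_on UNIV u" "continuous_on UNIV v" for u v :: "'a \<Rightarrow> real"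
    by (intro integrable_continuous continuous_intros that)
  note ints = int[OF ab(1) cont[OF ab(1)]] int[OF ab(2) cont[OF ab(2)]]
    int[OF ab(2) cont[OF ab(1)]] int[OF ab(1) cont[OF ab(2)]]
  have "(\<integral>x. \<integral>y. \<phi> x * cnj (\<phi> y) * of_real (G (- x + y)) \<partial>M \<partial>M) =
      (\<integral>x. complex_of_real (a x * ?A x + b x * ?B x) + \<i> * of_real (b x * ?A x - a x * ?B x) \<partial>M)"
    unfolding row by (intro Bochner_Integration.integral_cong) (simp_all add: \<phi>_eq algebra_simps)
  also have "\<dots> = (\<integral>x. complex_of_real (a x * ?A x + b x * ?B x) \<partial>M) +
      \<i> * (\<integral>x. complex_of_real (b x * ?A x - a x * ?B x) \<partial>M)"
    using ints by (subst Bochner_Integration.integral_add)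
      (auto intro!: integrable_of_real integrable_mult_right simp del: of_real_mult of_real_add of_real_diff)
  also have "\<dots> = of_real (ip a ?A + ip b ?B) + \<i> * of_real (ip b ?A - ip a ?B)"
    unfolding integral_complex_of_real using ints by (simp add: ip_def)
  also have "\<dots> = of_real (ip a ?A + ip b ?B)"
    using comm[OF ab] by simp
  also have "\<dots> \<in> \<real>\<^sub>\<ge>\<^sub>0"
    using nonneg[OF ab(1)] nonneg[OF ab(2)] by simp
  finally show "(\<integral>x. \<integral>y. \<phi> x * cnj (\<phi> y) * of_real (G (- x + y)) \<partial>M \<partial>M) \<in> \<real>\<^sub>\<ge>\<^sub>0" .
qed

section \<open>Passage to the limit\<close>

context pd_function
begin

text \<open>Translating the integration variable by \<open>k\<close> moves \<open>k\<close> onto the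
  left factor and leaves \<open>k'\<close> on the right one. As \<open>0 \<in> K\<close>, two-sided
  invariance yields each one-sided invariance.\<close>

lemma bi_invariant_act:
  assumes f: "bi_invariant K f" and 0: "0 \<in> K"
  shows "bi_invariant K (act p f)"
proof (induction p)
  case (pCons a p)
  let ?v = "act p f"
  have "T ?v (k + x + k') = T ?v x" if k: "k \<in> K" "k' \<in> K" for x k k'
  proof -
    have "continuous_on UNIV (\<lambda>y. ?v y * f (- y + (k + x + k')))"
      by (intro continuous_f[THEN continuous_comp] continuous_act continuous_f continuous_intros)
    from integral_translate[OF measurable_continuous[OF this], of k]
    have "T ?v (k + x + k') = (\<integral>y. ?v (k + y) * f (- (k + y) + (k + x + k')) \<partial>M)"
      by (simp add: rconv_def)
    also have "\<dots> = T ?v x"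
      unfolding rconv_def
    proof (rule Bochner_Integration.integral_cong)
      fix y
      have "?v (k + y) = ?v y"
        using pCons.IH k(1) 0 unfolding bi_invariant_def by (metis add.right_neutral)
      moreover have "- (k + y) + (k + x + k') = 0 + (- y + x) + k'"
        by (simp add: minus_add add.assoc del: add_uminus_conv_diff)
      then have "f (- (k + y) + (k + x + k')) = f (- y + x)"
        using f 0 k(2) unfolding bi_invariant_def by metis
      ultimately show "?v (k + y) * f (- (k + y) + (k + x + k')) = ?v y * f (- y + x)" by simp
    qed simp
    finally show ?thesis .
  qed
  then show ?case using f by (simp add: bi_invariant_def)
qed (simp add: bi_invariant_def)

text \<open>Convolution with \<open>approx n\<close> acts on \<open>b\<close> as the polynomial
  \<open>t * isq n\<close>, so positivity and symmetry of the pairing become statements about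
  \<open>act\<close>.\<close>

lemma ip_rconv_approx:
  assumes a: "continuous_on UNIV a" and b: "continuous_on UNIV b"
  shows "ip a (rconv b (approx n)) = ip a (act ([:0, 1:] * isq n) b)"
  unfolding approx_def by (simp only: rconv_act[OF b continuous_f] act_T[OF b] act_t_mult[OF b])

text \<open>The squared norms increase and stay below \<open>f 0\<close>, hence form a Cauchy
  sequence, and \<open>approx_diff_le\<close> bounds the squared distances by their
  differences.\<close>

lemma approx_cauchy:
  assumes e: "e > 0"
  shows "\<exists>N. \<forall>i\<ge>N. \<forall>j\<ge>N. (\<integral>x. (approx i x - approx j x)\<^sup>2 \<partial>M) < e"
proof -
  let ?n = "\<lambda>n. ip (approx n) (approx n)"
  have "incseq ?n"
  proof (rule incseq_SucI)
    fix n
    have "0 \<le> (\<integral>x. (approx (Suc n) x - approx n x)\<^sup>2 \<partial>M)" by simp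
    then show "?n n \<le> ?n (Suc n)" using approx_diff_le[OF le_SucI[OF order_refl], of n] by linarith
  qed
  then have "Cauchy ?n"
    using incseq_convergent[of ?n "f 0"] ip_approx_le LIMSEQ_imp_Cauchy by metis
  then obtain N where N: "\<forall>i\<ge>N. \<forall>j\<ge>N. dist (?n i) (?n j) < e"
    using e unfolding Cauchy_def by blast
  have *: "(\<integral>x. (approx i x - approx j x)\<^sup>2 \<partial>M) < e" if "i \<ge> N" "j \<ge> N" "j \<le> i" for i j
  proof -
    have "dist (?n i) (?n j) < e" using N that by blast
    then show ?thesis using approx_diff_le[OF that(3)] unfolding dist_real_def by linarith
  qed
  have "(\<integral>x. (approx i x - approx j x)\<^sup>2 \<partial>M) < e" if "i \<ge> N" "j \<ge> N" for i j
  proof (cases "j \<le> i")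
    case False
    then have "(\<integral>x. (approx j x - approx i x)\<^sup>2 \<partial>M) < e" using that by (intro *) auto
    then show ?thesis by (subst power2_commute)
  qed (use * that in auto)
  then show ?thesis by blast
qed

lemma convolution_root:
  obtains G where "sq_int M G" "\<And>x. G (- x) = G x"
    "\<And>K. bi_invariant K f \<Longrightarrow> 0 \<in> K \<Longrightarrow> bi_invariant K G"
    "\<And>a. continuous_on UNIV a \<Longrightarrow> continuous_on UNIV (rconv a G)"
    "\<And>a. continuous_on UNIV a \<Longrightarrow> ip a (rconv a G) \<ge> 0"
    "\<And>a b. continuous_on UNIV a \<Longrightarrow> continuous_on UNIV b \<Longrightarrow> ip a (rconv b G) = ip b (rconv a G)"
    "\<And>x. f x = rconv G G x"
proof -
  have sq: "sq_int M (approx n)" for n by (simp add: sq_int_continuous)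
  obtain r where r: "strict_mono r" "sq_int M (\<lambda>x. lim (\<lambda>k. approx (r k) x))"
    "(\<lambda>k. \<integral>x. (approx (r k) x - lim (\<lambda>l. approx (r l) x))\<^sup>2 \<partial>M) \<longlonglongrightarrow> 0"
    using L2_cauchy_limit[OF sq approx_cauchy] by blast
  define G where "G x = lim (\<lambda>k. approx (r k) x)" for x
  let ?g = "\<lambda>k. approx (r k)"
  have G: "sq_int M G" "(\<lambda>k. \<integral>x. (?g k x - G x)\<^sup>2 \<partial>M) \<longlonglongrightarrow> 0"
    using r(2,3) by (simp_all add: G_def[abs_def])
  have g_sym: "approx n (- x) = approx n x" for n x by (simp add: approx_def act_f_minus)
  \<comment> \<open>At \<open>- x\<close> and \<open>x\<close> the sequences coincide, so their
    \<open>lim\<close> agrees even where there is no convergence.\<close>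
  have G_sym: "G (- x) = G x" for x by (simp add: G_def g_sym)
  have bound: "(\<integral>y. (?g k y)\<^sup>2 \<partial>M) \<le> f 0" for k
    using ip_approx_le[of "r k"] by (simp add: ip_def power2_eq_square)
  have lim: "uniform_limit UNIV (\<lambda>k. rconv a (?g k)) (rconv a G) sequentially" if "continuous_on UNIV a" for a
    by (rule rconv_uniform_limit[where C = "f 0"])
      (use that sq G g_sym G_sym bound in \<open>auto intro: sq_int_continuous\<close>)
  have lim2: "uniform_limit UNIV (\<lambda>k. rconv (?g k) (?g k)) (rconv G G) sequentially"
    by (rule rconv_uniform_limit[where C = "f 0"]) (use sq G g_sym G_sym bound in auto)
  have cont_conv: "continuous_on UNIV (rconv a (?g k))" if "continuous_on UNIV a" for a k
    by (intro continuous_rconv that continuous_approx)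
  have ip_lim: "(\<lambda>k. ip a (rconv b (?g k))) \<longlonglongrightarrow> ip a (rconv b G)"
    if "continuous_on UNIV a" "continuous_on UNIV b" for a b
    by (intro ip_uniform_limit that cont_conv lim)
  show ?thesis
  proof (rule that[of G])
    show "sq_int M G" "\<And>x. G (- x) = G x" by (fact G G_sym)+
    show "bi_invariant K G" if "bi_invariant K f" "0 \<in> K" for K
      using bi_invariant_act[OF that] by (simp add: bi_invariant_def G_def approx_def)
    show "continuous_on UNIV (rconv a G)" if "continuous_on UNIV a" for a
      using uniform_limit_theorem[OF _ lim[OF that]] cont_conv[OF that] by simp
    show "ip a (rconv a G) \<ge> 0" if "continuous_on UNIV a" for a
    proof (rule LIMSEQ_le_const[OF ip_lim[OF that that]])
      have "0 \<le> ip a (rconv a (?g k))" for k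
        unfolding ip_rconv_approx[OF that that]
        by (subst ip_commute) (rule cone_positive[OF cone.t_mult[OF isq_cone] that])
      then show "\<exists>N. \<forall>k\<ge>N. 0 \<le> ip a (rconv a (?g k))" by blast
    qed
    show "ip a (rconv b G) = ip b (rconv a G)" if a: "continuous_on UNIV a" and b: "continuous_on UNIV b" for a b
    proof (rule LIMSEQ_unique[OF ip_lim[OF a b]])
      have "ip a (rconv b (?g k)) = ip b (rconv a (?g k))" for k
        unfolding ip_rconv_approx[OF a b] ip_rconv_approx[OF b a]
        using ip_act_commute[OF a b] by (metis ip_commute)
      then show "(\<lambda>k. ip a (rconv b (?g k))) \<longlonglongrightarrow> ip b (rconv a G)"
        using ip_lim[OF b a] by simp
    qed
    show "f x = rconv G G x" for x
    proof -
      let ?h = "\<lambda>k x. f x - rconv (?g k) (?g k) x"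
      have cG: "continuous_on UNIV (rconv G G)"
        using uniform_limit_theorem[OF _ lim2] cont_conv by simp
      \<comment> \<open>A bound independent of \<open>k\<close> and \<open>x\<close>, from the
        weight \<open>s = 1\<close>; it provides the dominating constant below.\<close>
      have conv_le: "\<bar>rconv (?g k) (?g k) x\<bar> \<le> f 0" for k x
      proof -
        have "\<bar>rconv (?g k) (?g k) x\<bar> \<le> (\<integral>y. \<bar>?g k y * ?g k (- y + x)\<bar> \<partial>M)"
          unfolding rconv_def by (rule integral_abs_bound)
        also have "\<dots> \<le> ((\<integral>y. (?g k y)\<^sup>2 \<partial>M) / 1 + 1 * (\<integral>y. (?g k (- y + x))\<^sup>2 \<partial>M)) / 2"
          by (intro integral_abs_mult_le sq sq_int_reflect g_sym) simp
        also have "\<dots> \<le> f 0"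
          using bound[of k] sq_int_reflect(2)[OF sq g_sym, of "r k" x] by simp
        finally show ?thesis .
      qed
      \<comment> \<open>The squared norm of the residual has two limits: that of
        \<open>f - rconv G G\<close> by dominated convergence, and 0 by \<open>residual\<close>.
        Continuity then turns equality in L2 into equality at every point.\<close>
      have "(\<lambda>k. \<integral>x. (?h k x)\<^sup>2 \<partial>M) \<longlonglongrightarrow> (\<integral>x. (f x - rconv G G x)\<^sup>2 \<partial>M)"
      proof (rule integral_dominated_convergence[where w = "\<lambda>x. (2 * f 0)\<^sup>2"])
        show "(\<lambda>x. (f x - rconv G G x)\<^sup>2) \<in> borel_measurable M"
          by (intro measurable_continuous continuous_intros continuous_f cG)
        show "(\<lambda>x. (?h k x)\<^sup>2) \<in> borel_measurable M" for k
          by (intro measurable_continuous continuous_intros continuous_f cont_conv continuous_approx)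
        show "AE x in M. (\<lambda>k. (?h k x)\<^sup>2) \<longlonglongrightarrow> (f x - rconv G G x)\<^sup>2"
          using tendsto_uniform_limitI[OF lim2] by (intro AE_I2 tendsto_intros) auto
        show "AE x in M. norm ((?h k x)\<^sup>2) \<le> (2 * f 0)\<^sup>2" for k
        proof (rule AE_I2)
          fix x
          have "\<bar>?h k x\<bar> \<le> \<bar>2 * f 0\<bar>" using abs_f_le[of x] conv_le[of k x] by linarith
          then show "norm ((?h k x)\<^sup>2) \<le> (2 * f 0)\<^sup>2" by (simp add: abs_le_square_iff)
        qed
      qed simp
      moreover have "(\<lambda>k. \<integral>x. (?h k x)\<^sup>2 \<partial>M) \<longlonglongrightarrow> 0"
      proof (rule LIMSEQ_I)
        fix e :: real assume "e > 0"
        \<comment> \<open>The 4 offsets the square of the factor 2 in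
          \<open>residual\<close>.\<close>
        then obtain N where N: "\<forall>i\<ge>N. \<forall>j\<ge>N. (\<integral>x. (approx i x - approx j x)\<^sup>2 \<partial>M) < e / 4"
          using approx_cauchy[of "e / 4"] by auto
        have "norm ((\<integral>x. (?h k x)\<^sup>2 \<partial>M) - 0) < e" if "k \<ge> N" for k
        proof -
          have "(\<integral>x. (approx (Suc (r k)) x - approx (r k) x)\<^sup>2 \<partial>M) < e / 4"
            using N that seq_suble[OF r(1), of k] by simp
          then show ?thesis unfolding residual power_mult_distrib by simp
        qed
        then show "\<exists>N. \<forall>k\<ge>N. norm ((\<integral>x. (?h k x)\<^sup>2 \<partial>M) - 0) < e" by blast
      qed
      ultimately have "(\<integral>x. (f x - rconv G G x)\<^sup>2 \<partial>M) = 0" by (rule LIMSEQ_unique)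
      from continuous_eq_0[OF _ this, of x] show ?thesis
        by (simp add: continuous_on_diff cG)
    qed
  qed
qed

end

section \<open>Normalising \<open>f\<close> and scaling back\<close>

theorem theorem21:
  fixes M :: "'a::{topological_group_add,t2_space} measure"
    and K :: "'a set"
    and f :: "'a \<Rightarrow> real"
  assumes "compact_gelfand_pair M K"
    and "continuous_on UNIV f"
    and "positive_definite (\<lambda>x. complex_of_real (f x))"
    and "bi_invariant K f"
  shows "\<exists>g :: 'a \<Rightarrow> complex.
           positive_definite_L2 M g \<and> bi_invariant K g \<and> square_integrable M g \<and>
           (\<forall>x. complex_of_real (f x) = convolution M g g x)"
proof -
  have haar: "left_haar_measure M" and K: "0 \<in> K" and cpt: "compact (UNIV :: 'a set)"
    using assms(1) unfolding compact_gelfand_pair_def gelfand_pair_def compact_subgroup_def by blast+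
  interpret compact_haar M by unfold_locales (fact haar cpt)+
  \<comment> \<open>The absolute value and the added 1 keep the denominator positive; the scaled
    function then satisfies \<open>bound_f\<close>.\<close>
  define c where "c = 1 / (\<bar>f 0\<bar> * measure M UNIV + 1)"
  have c: "c > 0" by (simp add: c_def add_nonneg_pos)
  interpret pd_function M "\<lambda>x. c * f x"
  proof
    show "continuous_on UNIV (\<lambda>x. c * f x)" by (intro continuous_intros assms)
    show "positive_definite (\<lambda>x. complex_of_real (c * f x))"
      unfolding positive_definite_def
    proof (intro allI)
      fix n :: nat and w :: "nat \<Rightarrow> complex" and x :: "nat \<Rightarrow> 'a"
      have "(\<Sum>i<n. \<Sum>j<n. w i * cnj (w j) * complex_of_real (c * f (- x i + x j))) =
          of_real c * (\<Sum>i<n. \<Sum>j<n. w i * cnj (w j) * complex_of_real (f (- x i + x j)))"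
        by (simp add: sum_distrib_left mult_ac)
      also have "\<dots> \<in> \<real>\<^sub>\<ge>\<^sub>0"
        using assms(3) c unfolding positive_definite_def by (intro nonneg_Reals_mult_I) auto
      finally show "(\<Sum>i<n. \<Sum>j<n. w i * cnj (w j) * complex_of_real (c * f (- x i + x j))) \<in> \<real>\<^sub>\<ge>\<^sub>0" .
    qed
    have "c * (f 0 * measure M UNIV) \<le> c * (\<bar>f 0\<bar> * measure M UNIV + 1)"
      using c by (intro mult_left_mono) (auto intro: order_trans[OF mult_right_mono[OF abs_ge_self]])
    also have "\<dots> = 1" using c by (simp add: c_def)
    finally show "c * f 0 * measure M UNIV \<le> 1" by (simp add: mult.assoc)
  qed
  obtain G where G: "sq_int M G" "\<And>x. G (- x) = G x"
    "\<And>K. bi_invariant K (\<lambda>x. c * f x) \<Longrightarrow> 0 \<in> K \<Longrightarrow> bi_invariant K G"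
    "\<And>a. continuous_on UNIV a \<Longrightarrow> continuous_on UNIV (rconv a G)"
    "\<And>a. continuous_on UNIV a \<Longrightarrow> ip a (rconv a G) \<ge> 0"
    "\<And>a b. continuous_on UNIV a \<Longrightarrow> continuous_on UNIV b \<Longrightarrow> ip a (rconv b G) = ip b (rconv a G)"
    "\<And>x. c * f x = rconv G G x"
    using convolution_root by blast
  \<comment> \<open>Convolution is bilinear, so a root of \<open>c * f\<close> becomes a root of
    \<open>f\<close> after multiplication by \<open>1 / sqrt c\<close>.\<close>
  define s where "s = 1 / sqrt c"
  have s: "s \<ge> 0" "s * s * c = 1" using c by (simp_all add: s_def)
  define H where "H x = s * G x" for x
  have H: "sq_int M H" using G(1) by (auto simp: H_def[abs_def] sq_int_def power_mult_distrib)
  have "positive_definite_L2 M (\<lambda>x. complex_of_real (H x))"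
  proof (rule positive_definite_L2_of_real[OF H])
    show "H (- x) = H x" for x by (simp add: H_def G)
    show "continuous_on UNIV (rconv a H)" if "continuous_on UNIV a" for a
      unfolding H_def[abs_def] rconv_scale_right by (intro continuous_intros G that)
    show "ip a (rconv a H) \<ge> 0" if "continuous_on UNIV a" for a
      unfolding H_def[abs_def] rconv_scale_right ip_scale_right using s G that by simp
    show "ip a (rconv b H) = ip b (rconv a H)" if "continuous_on UNIV a" "continuous_on UNIV b" for a b
      unfolding H_def[abs_def] rconv_scale_right ip_scale_right using G(6) that by simp
  qed
  moreover have "bi_invariant K (\<lambda>x. complex_of_real (H x))"
    using G(3)[of K] assms(4) K by (simp add: bi_invariant_def H_def)
  moreover have "square_integrable M (\<lambda>x. complex_of_real (H x))"
    using H by (auto simp: square_integrable_def sq_int_def)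
  moreover have "complex_of_real (f x) = convolution M (\<lambda>x. of_real (H x)) (\<lambda>x. of_real (H x)) x" for x
  proof -
    have "convolution M (\<lambda>x. of_real (H x)) (\<lambda>x. of_real (H x)) x = of_real (rconv H H x)"
      unfolding convolution_def rconv_def by (simp flip: of_real_mult)
    also have "rconv H H x = s * s * c * f x"
      unfolding H_def[abs_def] rconv_scale_left rconv_scale_right using G(7)[of x] by simp
    finally show ?thesis using s by simp
  qed
  ultimately show ?thesis by blast
qed

end
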